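(* Let $\mathcal T=(V,\mathcal E)$ be a countably infinite, leafless, rootless directed tree, let $\boldsymbol\lambda=\{\lambda_v\}_{v\in V}$ be a system of positive numbers such that the weighted shift $S_{\boldsymbol\lambda}$ is a bounded left-invertible operator on $\ell^2(V)$, and let $\boldsymbol\lambda'=\{\lambda'_v\}_{v\in V}$ be the weights of its Cauchy dual, $\lambda'_v=\lambda_v/\|S_{\boldsymbol\lambda}e_{\mathsf{par}(v)}\|^2$. Then $S_{\boldsymbol\lambda}$ has Wold-type decomposition if and only if exactly one of the following holds: (i) $\alpha_{\boldsymbol\lambda}(v)=\alpha_{\boldsymbol\lambda'}(v)=\infty$ for some (or equivalently, for all) $v\in V$; (ii) $\alpha_{\boldsymbol\lambda}(v)<\infty$ for some (or equivalently, for all) $v\in V$, $\lambda_v=\sqrt{\dfrac{\alpha_{\boldsymbol\lambda}(\mathsf{par}(v))}{\alpha_{\boldsymbol\lambda}(v)}}$ for all $v$ in a bilateral path (or equivalently, for all $v\in V$), and $S_{\boldsymbol\lambda}$ is a balanced weighted shift on $\mathcal T$.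
   Context: $\mathbb N$ denotes the non-negative integers. A directed tree $\mathcal T=(V,\mathcal E)$ is a directed graph (no self-loops) that is connected as an undirected graph, has no directed circuits, and in which each vertex $v$ has at most one parent, i.e. vertex $u$ with $(u,v)\in\mathcal E$. It is rootless if every $v$ has a parent, denoted $\mathsf{par}(v)$. Put $\mathsf{Chi}(u)=\{v:(u,v)\in\mathcal E\}$; $\mathcal T$ is leafless if $\mathsf{Chi}(u)\neq\emptyset$ for all $u$. For $W\subseteq V$, $\mathsf{Chi}(W)=\bigcup_{u\in W}\mathsf{Chi}(u)$; $\mathsf{Chi}^{\langle 0\rangle}(v)=\{v\}$, $\mathsf{Chi}^{\langle n\rangle}(v)=\mathsf{Chi}(\mathsf{Chi}^{\langle n-1\rangle}(v))$ for $n\geq1$; $\mathsf{par}^{\langle n\rangle}$ is the $n$-fold composition of $\mathsf{par}$ (identity for $n=0$). A bilateral path is a family $\{v_m\}_{m\in\mathbb Z}$ with $v_0\in V$, $v_m=\mathsf{par}^{\langle -m\rangle}(v_0)$ for $m\leq-1$, and $v_m$ any but fixed element of $\mathsf{Chi}(v_{m-1})$ for $m\geq1$. Vertices $u,v$ belong to the same generation if $\mathsf{par}^{\langle n\rangle}(u)=\mathsf{par}^{\langle n\rangle}(v)$ for some $n\in\mathbb N$. $\ell^2(V)$ is the Hilbert space of square summable complex functions on $V$, with orthonormal basis $e_u$ = indicator function of $\{u\}$. The weighted shift is $(S_{\boldsymbol\lambda}f)(v)=\lambda_v f(\mathsf{par}(v))$, $v\in V$. It is balanced if $\|S_{\boldsymbol\lambda}e_u\|=\|S_{\boldsymbol\lambda}e_v\|$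 for all $u,v$ in the same generation. For a system $\boldsymbol\lambda$ of positive numbers: $\boldsymbol\lambda^{(0)}(v)=1$ and $\boldsymbol\lambda^{(n)}(v)=\lambda_v\lambda_{\mathsf{par}(v)}\cdots\lambda_{\mathsf{par}^{\langle n-1\rangle}(v)}$ for $n\geq1$. Let $A(v,0)=\{v\}$ and $A(v,n)=\mathsf{Chi}^{\langle n\rangle}(\mathsf{par}^{\langle n\rangle}(v))\setminus\mathsf{Chi}^{\langle n-1\rangle}(\mathsf{par}^{\langle n-1\rangle}(v))$ for $n\geq1$. Define $\alpha_{\boldsymbol\lambda}(v)=\sum_{n=0}^\infty\sum_{u\in A(v,n)}\left(\frac{\boldsymbol\lambda^{(n)}(u)}{\boldsymbol\lambda^{(n)}(v)}\right)^2\in(0,\infty]$; $\alpha_{\boldsymbol\lambda'}$ is defined in the same way with $\boldsymbol\lambda'$ in place of $\boldsymbol\lambda$. For a left-invertible bounded operator $T$ on a complex Hilbert space $\mathcal H$: $T^\infty(\mathcal H)=\bigcap_{n\geq0}T^n\mathcal H$; for a subspace $\mathcal M$, $[\mathcal M]_T$ is the closed linear span of $\{T^nh:n\geq0,h\in\mathcal M\}$. $T$ has Wold-type decomposition if $T^\infty(\mathcal H)$ reduces $T$ to a unitary (that is, $T^\infty(\mathcal H)$ is reducing for $T$ and $T|_{T^\infty(\mathcal H)}$ is unitary) and $\mathcal H=T^\infty(\mathcal H)\oplus[\ker T^*]_T$. *)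

theory Defs
  imports "HOL-Analysis.Analysis" "HOL-Library.Function_Algebras"
begin

section \<open>Directed trees\<close>

definition directed_tree :: "'v set \<Rightarrow> ('v \<times> 'v) set \<Rightarrow> bool" where
  "directed_tree V E \<longleftrightarrow>
     E \<subseteq> V \<times> V \<and> irrefl E \<and> acyclic E \<and>
     (\<forall>u\<in>V. \<forall>v\<in>V. (u, v) \<in> (E \<union> E\<inverse>)\<^sup>*) \<and>
     (\<forall>v\<in>V. \<forall>u u'. (u, v) \<in> E \<longrightarrow> (u', v) \<in> E \<longrightarrow> u = u')"

definition rootless :: "'v set \<Rightarrow> ('v \<times> 'v) set \<Rightarrow> bool" where
  "rootless V E \<longleftrightarrow> (\<forall>v\<in>V. \<exists>u. (u, v) \<in> E)"

definition par :: "('v \<times> 'v) set \<Rightarrow> 'v \<Rightarrow> 'v" where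
  "par E v = (THE u. (u, v) \<in> E)"

definition Chi :: "('v \<times> 'v) set \<Rightarrow> 'v set \<Rightarrow> 'v set" where
  "Chi E W = (\<Union>u\<in>W. {v. (u, v) \<in> E})"

definition leafless :: "'v set \<Rightarrow> ('v \<times> 'v) set \<Rightarrow> bool" where
  "leafless V E \<longleftrightarrow> (\<forall>u\<in>V. Chi E {u} \<noteq> {})"

definition bilateral_path :: "'v set \<Rightarrow> ('v \<times> 'v) set \<Rightarrow> (int \<Rightarrow> 'v) \<Rightarrow> bool" where
  "bilateral_path V E p \<longleftrightarrow>
     p 0 \<in> V \<and>
     (\<forall>m\<le>-1. p m = (par E ^^ nat (- m)) (p 0)) \<and>
     (\<forall>m\<ge>1. p m \<in> Chi E {p (m - 1)})"

definition same_generation :: "('v \<times> 'v) set \<Rightarrow> 'v \<Rightarrow> 'v \<Rightarrow> bool" where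
  "same_generation E u v \<longleftrightarrow> (\<exists>n. (par E ^^ n) u = (par E ^^ n) v)"

section \<open>The Hilbert space of square summable functions on V and its operators\<close>

text \<open>Elements of \<open>\<ell>\<^sup>2(V)\<close> are represented by total functions vanishing outside \<open>V\<close>. Sums, differences
  and the zero vector are the pointwise ones of \<^theory>\<open>HOL-Library.Function_Algebras\<close>.\<close>

definition ell2 :: "'v set \<Rightarrow> ('v \<Rightarrow> complex) set" where
  "ell2 V = {f. (\<forall>v. v \<notin> V \<longrightarrow> f v = 0) \<and> (\<lambda>v. (cmod (f v))\<^sup>2) summable_on V}"

definition ell2_inner :: "'v set \<Rightarrow> ('v \<Rightarrow> complex) \<Rightarrow> ('v \<Rightarrow> complex) \<Rightarrow> complex" where
  "ell2_inner V f g = (\<Sum>\<^sub>\<infinity>v\<in>V. f v * cnj (g v))"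

definition ell2_norm :: "'v set \<Rightarrow> ('v \<Rightarrow> complex) \<Rightarrow> real" where
  "ell2_norm V f = sqrt (\<Sum>\<^sub>\<infinity>v\<in>V. (cmod (f v))\<^sup>2)"

definition scaleC :: "complex \<Rightarrow> ('v \<Rightarrow> complex) \<Rightarrow> 'v \<Rightarrow> complex" where
  "scaleC c f = (\<lambda>v. c * f v)"

global_interpretation cfun: vector_space scaleC
  defines cspan = cfun.span and csubspace = cfun.subspace
  by unfold_locales (auto simp: scaleC_def fun_eq_iff algebra_simps)

lemma ell2_diff:
  assumes "f \<in> ell2 V" "g \<in> ell2 V"
  shows "f - g \<in> ell2 V"
proof -
  have "(\<lambda>v. 2 * (cmod (f v))\<^sup>2 + 2 * (cmod (g v))\<^sup>2) summable_on V"
    using assms by (intro summable_on_add summable_on_cmult_right) (auto simp: ell2_def)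
  moreover have "(cmod (f v - g v))\<^sup>2 \<le> 2 * (cmod (f v))\<^sup>2 + 2 * (cmod (g v))\<^sup>2" for v
  proof -
    have "(cmod (f v - g v))\<^sup>2 \<le> (cmod (f v) + cmod (g v))\<^sup>2"
      by (intro power_mono norm_triangle_ineq4) auto
    also have "\<dots> \<le> 2 * (cmod (f v))\<^sup>2 + 2 * (cmod (g v))\<^sup>2"
      using sum_squares_bound[of "cmod (f v)" "cmod (g v)"] by (simp add: power2_sum)
    finally show ?thesis .
  qed
  ultimately have "(\<lambda>v. (cmod (f v - g v))\<^sup>2) summable_on V"
    by (rule summable_on_comparison_test) auto
  then show ?thesis
    using assms by (simp add: ell2_def)
qed

lemma L2_set_le_ell2_norm:
  assumes "f \<in> ell2 V" "finite F" "F \<subseteq> V"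
  shows "L2_set (\<lambda>v. cmod (f v)) F \<le> ell2_norm V f"
  unfolding L2_set_def ell2_norm_def
  using assms by (intro real_sqrt_le_mono finite_sum_le_infsum) (auto simp: ell2_def)

lemma ell2_norm_triangle:
  assumes "f \<in> ell2 V" "g \<in> ell2 V" "h \<in> ell2 V" "h = f + g"
  shows "ell2_norm V h \<le> ell2_norm V f + ell2_norm V g"
proof -
  have nonneg: "ell2_norm V f + ell2_norm V g \<ge> 0"
    by (auto simp: ell2_norm_def intro!: infsum_nonneg add_nonneg_nonneg)
  have "(\<Sum>\<^sub>\<infinity>v\<in>V. (cmod (h v))\<^sup>2) \<le> (ell2_norm V f + ell2_norm V g)\<^sup>2"
  proof (rule infsum_le_finite_sums)
    show "(\<lambda>v. (cmod (h v))\<^sup>2) summable_on V"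
      using assms(3) by (simp add: ell2_def)
    fix F assume F: "finite F" "F \<subseteq> V"
    have "L2_set (\<lambda>v. cmod (h v)) F \<le> L2_set (\<lambda>v. cmod (f v) + cmod (g v)) F"
      using assms(4) by (intro L2_set_mono) (auto intro: norm_triangle_ineq)
    also have "\<dots> \<le> L2_set (\<lambda>v. cmod (f v)) F + L2_set (\<lambda>v. cmod (g v)) F"
      by (rule L2_set_triangle_ineq)
    also have "\<dots> \<le> ell2_norm V f + ell2_norm V g"
      using assms F by (intro add_mono L2_set_le_ell2_norm)
    finally show "(\<Sum>v\<in>F. (cmod (h v))\<^sup>2) \<le> (ell2_norm V f + ell2_norm V g)\<^sup>2"
      by (auto simp: L2_set_def dest: sqrt_le_D)
  qed
  then show ?thesis
    unfolding ell2_norm_def[of V h] using nonneg by (rule real_le_lsqrt[rotated])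
qed

global_interpretation ell2: Metric_space "ell2 V" "\<lambda>f g. ell2_norm V (f - g)" for V :: "'v set"
  defines ell2_topology = ell2.mtopology
proof
  fix f g h :: "'v \<Rightarrow> complex"
  show "0 \<le> ell2_norm V (f - g)"
    by (simp add: ell2_norm_def infsum_nonneg)
  show "ell2_norm V (f - g) = ell2_norm V (g - f)"
    by (simp add: ell2_norm_def norm_minus_commute)
  show "ell2_norm V (f - g) = 0 \<longleftrightarrow> f = g" if fg: "f \<in> ell2 V" "g \<in> ell2 V"
  proof
    assume "ell2_norm V (f - g) = 0"
    then have *: "(\<Sum>\<^sub>\<infinity>v\<in>V. (cmod ((f - g) v))\<^sup>2) \<le> 0"
      by (simp add: ell2_norm_def)
    have "(cmod ((f - g) v))\<^sup>2 = 0" if "v \<in> V" for v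
      using ell2_diff[OF fg] that by (intro nonneg_infsum_le_0D[OF *]) (auto simp: ell2_def)
    then show "f = g"
      using fg by (auto simp: fun_eq_iff ell2_def) (metis eq_iff_diff_eq_0)
  qed (simp add: ell2_norm_def)
  show "ell2_norm V (f - h) \<le> ell2_norm V (f - g) + ell2_norm V (g - h)"
    if "f \<in> ell2 V" "g \<in> ell2 V" "h \<in> ell2 V"
    using that by (intro ell2_norm_triangle ell2_diff) auto
qed

definition orth :: "'v set \<Rightarrow> ('v \<Rightarrow> complex) set \<Rightarrow> ('v \<Rightarrow> complex) set" where
  "orth V M = {f \<in> ell2 V. \<forall>g\<in>M. ell2_inner V f g = 0}"

type_synonym 'v operator = "('v \<Rightarrow> complex) \<Rightarrow> 'v \<Rightarrow> complex"

definition bounded_operator :: "'v set \<Rightarrow> 'v operator \<Rightarrow> bool" where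
  "bounded_operator V T \<longleftrightarrow>
     (\<forall>f\<in>ell2 V. T f \<in> ell2 V) \<and>
     (\<forall>f\<in>ell2 V. \<forall>g\<in>ell2 V. T (f + g) = T f + T g) \<and>
     (\<forall>c. \<forall>f\<in>ell2 V. T (scaleC c f) = scaleC c (T f)) \<and>
     (\<exists>C. \<forall>f\<in>ell2 V. ell2_norm V (T f) \<le> C * ell2_norm V f)"

definition left_invertible :: "'v set \<Rightarrow> 'v operator \<Rightarrow> bool" where
  "left_invertible V T \<longleftrightarrow> (\<exists>L. bounded_operator V L \<and> (\<forall>f\<in>ell2 V. L (T f) = f))"

definition ell2_adjoint :: "'v set \<Rightarrow> 'v operator \<Rightarrow> 'v operator" where
  "ell2_adjoint V T f =
     (THE h. h \<in> ell2 V \<and> (\<forall>g\<in>ell2 V. ell2_inner V (T g) f = ell2_inner V g h))"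

definition ker :: "'v set \<Rightarrow> 'v operator \<Rightarrow> ('v \<Rightarrow> complex) set" where
  "ker V T = {f \<in> ell2 V. T f = 0}"

definition reduces :: "'v set \<Rightarrow> ('v \<Rightarrow> complex) set \<Rightarrow> 'v operator \<Rightarrow> bool" where
  "reduces V M T \<longleftrightarrow>
     csubspace M \<and> closedin (ell2_topology V) M \<and> T ` M \<subseteq> M \<and> T ` orth V M \<subseteq> orth V M"

definition unitary_on :: "'v set \<Rightarrow> ('v \<Rightarrow> complex) set \<Rightarrow> 'v operator \<Rightarrow> bool" where
  "unitary_on V M T \<longleftrightarrow>
     T ` M = M \<and> (\<forall>f\<in>M. \<forall>g\<in>M. ell2_inner V (T f) (T g) = ell2_inner V f g)"

definition hyper_range :: "'v set \<Rightarrow> 'v operator \<Rightarrow> ('v \<Rightarrow> complex) set" where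
  "hyper_range V T = (\<Inter>n. (T ^^ n) ` ell2 V)"

definition generated :: "'v set \<Rightarrow> 'v operator \<Rightarrow> ('v \<Rightarrow> complex) set \<Rightarrow> ('v \<Rightarrow> complex) set" where
  "generated V T M = ell2_topology V closure_of cspan {(T ^^ n) h | n h. h \<in> M}"

definition orth_direct_sum ::
    "'v set \<Rightarrow> ('v \<Rightarrow> complex) set \<Rightarrow> ('v \<Rightarrow> complex) set \<Rightarrow> ('v \<Rightarrow> complex) set \<Rightarrow> bool" where
  "orth_direct_sum V H M N \<longleftrightarrow>
     H = {f + g | f g. f \<in> M \<and> g \<in> N} \<and> (\<forall>f\<in>M. \<forall>g\<in>N. ell2_inner V f g = 0)"

definition wold_type_decomposition :: "'v set \<Rightarrow> 'v operator \<Rightarrow> bool" where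
  "wold_type_decomposition V T \<longleftrightarrow>
     reduces V (hyper_range V T) T \<and>
     unitary_on V (hyper_range V T) T \<and>
     orth_direct_sum V (ell2 V) (hyper_range V T) (generated V T (ker V (ell2_adjoint V T)))"

section \<open>Weighted shifts\<close>

definition wshift :: "'v set \<Rightarrow> ('v \<times> 'v) set \<Rightarrow> ('v \<Rightarrow> real) \<Rightarrow> 'v operator" where
  "wshift V E lam f = (\<lambda>v. if v \<in> V then of_real (lam v) * f (par E v) else 0)"

text \<open>The basis vector \<open>e\<^sub>u\<close> is \<open>indicator {u}\<close>.\<close>

definition balanced :: "'v set \<Rightarrow> ('v \<times> 'v) set \<Rightarrow> ('v \<Rightarrow> real) \<Rightarrow> bool" where
  "balanced V E lam \<longleftrightarrow>
     (\<forall>u\<in>V. \<forall>v\<in>V. same_generation E u v \<longrightarrow>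
        ell2_norm V (wshift V E lam (indicator {u})) = ell2_norm V (wshift V E lam (indicator {v})))"

definition wpow :: "('v \<times> 'v) set \<Rightarrow> ('v \<Rightarrow> real) \<Rightarrow> nat \<Rightarrow> 'v \<Rightarrow> real" where
  "wpow E lam n v = (\<Prod>i<n. lam ((par E ^^ i) v))"

primrec gen_layer :: "('v \<times> 'v) set \<Rightarrow> 'v \<Rightarrow> nat \<Rightarrow> 'v set" where
  "gen_layer E v 0 = {v}"
| "gen_layer E v (Suc n) =
     (Chi E ^^ Suc n) {(par E ^^ Suc n) v} - (Chi E ^^ n) {(par E ^^ n) v}"

text \<open>The layers may be infinite. All terms are nonnegative, so the sums exist in \<^typ>\<open>ennreal\<close>.\<close>

definition alpha :: "('v \<times> 'v) set \<Rightarrow> ('v \<Rightarrow> real) \<Rightarrow> 'v \<Rightarrow> ennreal" where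
  "alpha E lam v =
     (\<Sum>n. \<Sum>\<^sub>\<infinity>u\<in>gen_layer E v n. ennreal ((wpow E lam n u / wpow E lam n v)\<^sup>2))"

text \<open>Meaningful where \<^const>\<open>alpha\<close> is finite, since \<^term>\<open>enn2real \<infinity> = 0\<close>.\<close>

definition alpha_weight_eq :: "('v \<times> 'v) set \<Rightarrow> ('v \<Rightarrow> real) \<Rightarrow> 'v \<Rightarrow> bool" where
  "alpha_weight_eq E lam v \<longleftrightarrow>
     lam v = sqrt (enn2real (alpha E lam (par E v)) / enn2real (alpha E lam v))"

end

theory Submission
  imports Defs
begin

text \<open>
  Let \<open>S\<close> be the weighted shift and \<open>S'\<close> the shift with the dual weights. Everything rests on two explicit
  descriptions.

  \<^item> The hyper-range. Since \<open>(S\<^sup>n g)(v) = \<lambda>\<^sup>n(v) g(par\<^sup>n v)\<close>, a function lies in the range of every \<open>S\<^sup>n\<close>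
    exactly if it is \<^emph>\<open>coherent\<close>: \<open>f(u) \<lambda>\<^sup>n(v) = f(v) \<lambda>\<^sup>n(u)\<close> whenever \<open>u\<close> and \<open>v\<close> have the same \<open>n\<close>-th ancestor
    (\<open>hyper_range_eq_coherent\<close>; that the preimages are square summable follows from \<open>S\<close> being bounded
    below). On the generation of \<open>v\<close> a coherent function is thus a multiple of one function \<open>h\<^sub>v\<close>, normalised
    by \<open>h\<^sub>v(v) = 1\<close>, and \<open>\<alpha>(v)\<close> is exactly the squared norm of \<open>h\<^sub>v\<close> (\<open>alpha_eq_infsum\<close>). The identity
    \<open>S h\<^sub>u = \<lambda>\<^sub>v h\<^sub>v\<close> for the parent \<open>u\<close> of \<open>v\<close> shows that \<open>\<alpha>\<close> is finite everywhere or nowhere.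

  \<^item> The complement of the wandering part. As \<open>\<langle>S' f, S g\<rangle> = \<langle>f, g\<rangle>\<close>, the orthogonal complement of
    \<open>[ker S\<^sup>*]\<close> is the hyper-range of \<open>S'\<close> (\<open>orth_generated_eq_dual_coherent\<close>, Shimorin's duality).

  By the projection theorem the direct sum condition therefore says that \<open>S\<close> and \<open>S'\<close> have the same
  coherent functions. This equality also makes the hyper-range reducing, so a Wold-type decomposition
  amounts to the equality together with \<open>S\<close> being isometric on coherent functions
  (\<open>wold_type_decomposition_iff\<close>).

  If \<open>\<alpha>\<close> is infinite then only \<open>0\<close> is coherent for \<open>S\<close>, and the criterion says that only \<open>0\<close> is coherent
  for \<open>S'\<close>, which means that the \<open>\<alpha>\<close> of the dual weights is infinite as well. If \<open>\<alpha>\<close> is finite, then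
  \<open>\<lambda>\<^sub>v = sqrt (\<alpha>(par v) / \<alpha>(v))\<close> says that \<open>S\<close> preserves the norm of \<open>h\<close> at the parent of \<open>v\<close>. Equality of the
  two spaces of coherent functions forces \<open>\<parallel>S e\<^sub>u\<parallel>\<close> to be constant on generations, that is, \<open>S\<close> is balanced.
  Conversely, a balanced \<open>S\<close> multiplies the norm of functions on a generation by a constant; if it
  preserves the norms of the vectors \<open>h\<^sub>v\<close>, all these constants are \<open>1\<close>. Then \<open>S\<close> coincides with \<open>S'\<close> and is an
  isometry, so the criterion holds.

  Finally, the condition on \<open>\<lambda>\<^sub>v\<close> depends only on the generation of \<open>v\<close>, because the vectors \<open>h\<close> of one
  generation are proportional, and a bilateral path meets every generation.
\<close>

section \<open>The Hilbert space of square summable functions\<close>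

lemma ell2_zero [simp]: "0 \<in> ell2 V"
  by (simp add: ell2_def)

lemma ell2_scaleC:
  assumes "f \<in> ell2 V"
  shows "scaleC c f \<in> ell2 V"
  using assms by (auto simp: ell2_def scaleC_def norm_mult power_mult_distrib intro: summable_on_cmult_right)

lemma ell2_add:
  assumes "f \<in> ell2 V" "g \<in> ell2 V"
  shows "f + g \<in> ell2 V"
  using ell2_diff[OF assms(1) ell2_scaleC[OF assms(2), of "-1"]]
  by (simp add: scaleC_def fun_diff_def plus_fun_def)

lemma ell2_finite_support:
  assumes "finite F" "F \<subseteq> V" "\<And>v. v \<notin> F \<Longrightarrow> f v = 0"
  shows "f \<in> ell2 V"
proof -
  have "(\<lambda>v. (cmod (f v))\<^sup>2) summable_on F"
    using assms by simp
  then have "(\<lambda>v. (cmod (f v))\<^sup>2) summable_on V"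
    using assms by (elim summable_on_cong_neutral[THEN iffD1, rotated -1]) auto
  then show ?thesis
    using assms by (auto simp: ell2_def)
qed

lemma ell2_indicator:
  assumes "u \<in> V"
  shows "indicator {u} \<in> ell2 V"
  using assms by (intro ell2_finite_support[of "{u}"]) auto

lemma ell2_norm_nonneg [simp]: "0 \<le> ell2_norm V f"
  by (simp add: ell2_norm_def infsum_nonneg)

lemma ell2_norm_square: "(ell2_norm V f)\<^sup>2 = (\<Sum>\<^sub>\<infinity>v\<in>V. (cmod (f v))\<^sup>2)"
  by (simp add: ell2_norm_def infsum_nonneg)

lemma ell2_inner_abs_summable:
  assumes "f \<in> ell2 V" "g \<in> ell2 V"
  shows "(\<lambda>v. norm (f v * cnj (g v))) summable_on V"
proof (rule abs_summable_product)
  show "(\<lambda>v. norm (f v * f v)) summable_on V" "(\<lambda>v. norm (cnj (g v) * cnj (g v))) summable_on V"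
    using assms by (simp_all add: ell2_def norm_mult power2_eq_square)
qed

lemma ell2_inner_summable:
  assumes "f \<in> ell2 V" "g \<in> ell2 V"
  shows "(\<lambda>v. f v * cnj (g v)) summable_on V"
  using ell2_inner_abs_summable[OF assms] by (rule abs_summable_summable)

lemma ell2_inner_add_left:
  assumes "f \<in> ell2 V" "g \<in> ell2 V" "h \<in> ell2 V"
  shows "ell2_inner V (f + g) h = ell2_inner V f h + ell2_inner V g h"
  using assms by (simp add: ell2_inner_def algebra_simps infsum_add ell2_inner_summable)

lemma ell2_inner_diff_left:
  assumes "f \<in> ell2 V" "g \<in> ell2 V" "h \<in> ell2 V"
  shows "ell2_inner V (f - g) h = ell2_inner V f h - ell2_inner V g h"
  using ell2_inner_add_left[OF ell2_diff[OF assms(1,2)] assms(2,3)] by simp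

lemma ell2_inner_scaleC_left: "ell2_inner V (scaleC c f) g = c * ell2_inner V f g"
  by (simp add: ell2_inner_def scaleC_def mult.assoc infsum_cmult_right')

lemma ell2_inner_commute: "ell2_inner V g f = cnj (ell2_inner V f g)"
  by (simp add: ell2_inner_def mult.commute flip: infsum_cnj)

lemma ell2_inner_add_right:
  assumes "f \<in> ell2 V" "g \<in> ell2 V" "h \<in> ell2 V"
  shows "ell2_inner V h (f + g) = ell2_inner V h f + ell2_inner V h g"
  using ell2_inner_add_left[OF assms] by (simp add: ell2_inner_commute[of V h])

lemma ell2_inner_diff_right:
  assumes "f \<in> ell2 V" "g \<in> ell2 V" "h \<in> ell2 V"
  shows "ell2_inner V h (f - g) = ell2_inner V h f - ell2_inner V h g"
  using ell2_inner_diff_left[OF assms] by (simp add: ell2_inner_commute[of V h])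

lemma ell2_inner_scaleC_right: "ell2_inner V g (scaleC c f) = cnj c * ell2_inner V g f"
  using ell2_inner_scaleC_left[of V c f g] by (simp add: ell2_inner_commute[of V g])

lemma ell2_inner_zero [simp]: "ell2_inner V 0 f = 0" "ell2_inner V f 0 = 0"
  by (simp_all add: ell2_inner_def)

lemma ell2_inner_self:
  assumes "f \<in> ell2 V"
  shows "ell2_inner V f f = of_real ((ell2_norm V f)\<^sup>2)"
  unfolding ell2_inner_def ell2_norm_square complex_norm_square[symmetric] of_real_power[symmetric]
  using assms by (intro infsumI has_sum_of_real has_sum_infsum) (simp add: ell2_def)

lemma ell2_norm_eq_0:
  assumes "f \<in> ell2 V" "ell2_norm V f = 0"
  shows "f = 0"
  using ell2.zero[of f V 0] assms by simp

lemma ell2_norm_square_add: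
  assumes "f \<in> ell2 V" "g \<in> ell2 V"
  shows "(ell2_norm V (f + g))\<^sup>2 = (ell2_norm V f)\<^sup>2 + 2 * Re (ell2_inner V f g) + (ell2_norm V g)\<^sup>2"
proof -
  have "complex_of_real ((ell2_norm V (f + g))\<^sup>2)
      = of_real ((ell2_norm V f)\<^sup>2) + (ell2_inner V f g + cnj (ell2_inner V f g)) + of_real ((ell2_norm V g)\<^sup>2)"
    using assms ell2_inner_commute[of V g f]
    by (simp add: ell2_inner_self[symmetric] ell2_inner_add_left ell2_inner_add_right ell2_add
        del: of_real_power)
  also have "\<dots> = of_real ((ell2_norm V f)\<^sup>2 + 2 * Re (ell2_inner V f g) + (ell2_norm V g)\<^sup>2)"
    by (simp only: complex_add_cnj of_real_add)
  finally show ?thesis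
    by (simp only: of_real_eq_iff)
qed

lemma ell2_norm_scaleC: "ell2_norm V (scaleC c f) = cmod c * ell2_norm V f"
  by (simp add: ell2_norm_def scaleC_def norm_mult power_mult_distrib infsum_cmult_right' real_sqrt_mult)

text \<open>Squaring the triangle inequality bounds the real part of the inner product; a rotation by the
  phase of the inner product makes its real part equal to its modulus.\<close>

lemma ell2_Cauchy_Schwarz:
  assumes f: "f \<in> ell2 V" and g: "g \<in> ell2 V"
  shows "cmod (ell2_inner V f g) \<le> ell2_norm V f * ell2_norm V g"
proof -
  have *: "Re (ell2_inner V f' g) \<le> ell2_norm V f' * ell2_norm V g" if "f' \<in> ell2 V" for f'
  proof -
    have "(ell2_norm V (f' + g))\<^sup>2 \<le> (ell2_norm V f' + ell2_norm V g)\<^sup>2"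
      using that g by (intro power_mono ell2_norm_triangle ell2_add) auto
    then show ?thesis
      using ell2_norm_square_add[OF that g] by (simp add: power2_sum)
  qed
  define c where "c = cnj (sgn (ell2_inner V f g))"
  have c: "c * ell2_inner V f g = of_real (cmod (ell2_inner V f g))"
    by (simp add: c_def sgn_eq complex_norm_square[symmetric] power2_eq_square mult.commute[of "cnj _"])
  have "cmod (ell2_inner V f g) = Re (ell2_inner V (scaleC c f) g)"
    by (simp add: ell2_inner_scaleC_left c)
  also have "\<dots> \<le> cmod c * ell2_norm V f * ell2_norm V g"
    using *[of "scaleC c f"] f by (simp add: ell2_scaleC ell2_norm_scaleC)
  also have "\<dots> \<le> 1 * ell2_norm V f * ell2_norm V g"
    by (intro mult_right_mono) (auto simp: c_def norm_sgn)
  finally show ?thesis by simp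
qed

lemma ell2_norm_indicator:
  assumes "u \<in> V"
  shows "ell2_norm V (indicator {u}) = 1"
proof -
  have "(\<Sum>\<^sub>\<infinity>v\<in>V. (cmod (indicator {u} v))\<^sup>2) = (\<Sum>\<^sub>\<infinity>v\<in>{u}. (cmod (indicator {u} v))\<^sup>2)"
    using assms by (intro infsum_cong_neutral) auto
  then show ?thesis
    by (simp add: ell2_norm_def)
qed

lemma ell2_inner_indicator:
  assumes "u \<in> V"
  shows "ell2_inner V f (scaleC a (indicator {u})) = cnj a * f u"
proof -
  have "ell2_inner V f (indicator {u}) = infsum (\<lambda>v. f v * cnj (indicator {u} v)) {u}"
    unfolding ell2_inner_def using assms by (intro infsum_cong_neutral) auto
  then show ?thesis
    by (simp add: ell2_inner_scaleC_right)
qed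

lemma infsum_ennreal_square:
  assumes "f \<in> ell2 V"
  shows "(\<Sum>\<^sub>\<infinity>u\<in>V. ennreal ((cmod (f u))\<^sup>2)) = ennreal ((ell2_norm V f)\<^sup>2)"
proof -
  have "(\<lambda>u. (cmod (f u))\<^sup>2) summable_on V"
    using assms by (simp add: ell2_def)
  then have "ennreal (infsum (\<lambda>u. (cmod (f u))\<^sup>2) V) = (SUP F\<in>{F. finite F \<and> F \<subseteq> V}. ennreal (\<Sum>u\<in>F. (cmod (f u))\<^sup>2))"
    by (rule infsum_nonneg_is_SUPREMUM_ennreal) auto
  then show ?thesis
    by (simp add: ell2_norm_square nonneg_infsum_complete sum_ennreal)
qed

lemma ell2_if_infsum_ennreal_finite:
  assumes "\<And>v. v \<notin> V \<Longrightarrow> f v = 0" and fin: "(\<Sum>\<^sub>\<infinity>u\<in>V. ennreal ((cmod (f u))\<^sup>2)) < \<infinity>"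
  shows "f \<in> ell2 V"
proof -
  obtain b where b: "b \<ge> 0" "(\<Sum>\<^sub>\<infinity>u\<in>V. ennreal ((cmod (f u))\<^sup>2)) = ennreal b"
    using fin by (cases "\<Sum>\<^sub>\<infinity>u\<in>V. ennreal ((cmod (f u))\<^sup>2)") auto
  have "(\<Sum>u\<in>F. (cmod (f u))\<^sup>2) \<le> b" if "finite F" "F \<subseteq> V" for F
  proof -
    have "(\<Sum>u\<in>F. ennreal ((cmod (f u))\<^sup>2)) \<le> ennreal b"
      unfolding b(2)[symmetric] using that by (subst nonneg_infsum_complete) (auto intro!: SUP_upper)
    then show ?thesis
      using b(1) by (simp add: sum_ennreal)
  qed
  then have "(\<lambda>u. (cmod (f u))\<^sup>2) summable_on V"
    by (intro nonneg_bdd_above_summable_on bdd_aboveI[of _ b]) auto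
  then show ?thesis
    using assms by (simp add: ell2_def)
qed

lemma ell2_complete: "Metric_space.mcomplete (ell2 V) (\<lambda>f g. ell2_norm V (f - g))"
  unfolding ell2.mcomplete_def
proof (intro allI impI)
  fix s :: "nat \<Rightarrow> 'a \<Rightarrow> complex"
  assume s: "ell2.MCauchy V s"
  then have mem: "s n \<in> ell2 V" for n
    by (auto simp: ell2.MCauchy_def)
  have cau: "\<exists>N. \<forall>n\<ge>N. \<forall>m\<ge>N. ell2_norm V (s n - s m) < e" if "e > 0" for e
    using s that unfolding ell2.MCauchy_def by meson
  have pt: "cmod (s n v - s m v) \<le> ell2_norm V (s n - s m)" if "v \<in> V" for n m v
    using L2_set_le_ell2_norm[OF ell2_diff[OF mem mem], of "{v}" n m] that by simp
  have "\<exists>l. (\<lambda>n. s n v) \<longlonglongrightarrow> l" for v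
  proof (cases "v \<in> V")
    case True
    have "Cauchy (\<lambda>n. s n v)"
      unfolding Cauchy_def dist_norm using cau pt[OF True] by (meson order_le_less_trans)
    then show ?thesis
      by (simp add: Cauchy_convergent_iff convergent_def)
  next
    case False
    then have "(\<lambda>n. s n v) = (\<lambda>n. 0)"
      using mem by (auto simp: ell2_def)
    then show ?thesis
      by auto
  qed
  then obtain l where l: "\<And>v. (\<lambda>n. s n v) \<longlonglongrightarrow> l v"
    by metis
  have l0: "l v = 0" if "v \<notin> V" for v
  proof -
    have "(\<lambda>n. s n v) = (\<lambda>n. 0)"
      using mem that by (auto simp: ell2_def)
    then show ?thesis
      using l[of v] by (simp add: LIMSEQ_const_iff)
  qed
  (* On finitely many vertices the Cauchy estimate passes to the pointwise limit in one index;
     bounds that are uniform over all finite sets then bound the whole norm. *)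
  have fin: "(\<Sum>v\<in>F. (cmod (s n v - l v))\<^sup>2) \<le> e\<^sup>2"
    if N: "\<forall>m\<ge>N. ell2_norm V (s n - s m) < e" and F: "finite F" "F \<subseteq> V" for n N e F
  proof (rule LIMSEQ_le_const2)
    show "(\<lambda>m. \<Sum>v\<in>F. (cmod (s n v - s m v))\<^sup>2) \<longlonglongrightarrow> (\<Sum>v\<in>F. (cmod (s n v - l v))\<^sup>2)"
      by (intro tendsto_intros l)
    have "(\<Sum>v\<in>F. (cmod (s n v - s m v))\<^sup>2) \<le> e\<^sup>2" if "m \<ge> N" for m
    proof -
      have "sqrt (\<Sum>v\<in>F. (cmod (s n v - s m v))\<^sup>2) \<le> e"
        using L2_set_le_ell2_norm[OF ell2_diff[OF mem mem] F, of n m] N that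
        by (auto simp: L2_set_def intro: order_trans less_imp_le)
      then show ?thesis
        by (rule sqrt_le_D)
    qed
    then show "\<exists>N. \<forall>m\<ge>N. (\<Sum>v\<in>F. (cmod (s n v - s m v))\<^sup>2) \<le> e\<^sup>2"
      by blast
  qed
  have diff: "s n - l \<in> ell2 V" if N: "\<forall>m\<ge>N. ell2_norm V (s n - s m) < e" for n N e
  proof -
    have "(\<lambda>v. (cmod ((s n - l) v))\<^sup>2) summable_on V"
      using fin[OF N] by (intro nonneg_bdd_above_summable_on bdd_aboveI[of _ "e\<^sup>2"]) auto
    then show ?thesis
      using mem l0 by (auto simp: ell2_def)
  qed
  have close: "ell2_norm V (s n - l) \<le> e" if N: "\<forall>m\<ge>N. ell2_norm V (s n - s m) < e" and "e > 0" for n N e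
  proof -
    have "(\<Sum>\<^sub>\<infinity>v\<in>V. (cmod ((s n - l) v))\<^sup>2) \<le> e\<^sup>2"
      using diff[OF N] fin[OF N] by (intro infsum_le_finite_sums) (auto simp: ell2_def)
    then show ?thesis
      unfolding ell2_norm_def using that by (intro real_le_lsqrt) auto
  qed
  have lmem: "l \<in> ell2 V"
  proof -
    obtain N where "\<forall>n\<ge>N. \<forall>m\<ge>N. ell2_norm V (s n - s m) < 1"
      using cau[of 1] by auto
    then have "s N - (s N - l) \<in> ell2 V"
      by (intro ell2_diff mem diff) auto
    then show ?thesis by simp
  qed
  have "limitin (ell2_topology V) s l sequentially"
    unfolding ell2.limitin_metric
  proof (intro conjI lmem allI impI)
    fix e :: real assume e: "e > 0"
    then obtain N where N: "\<forall>n\<ge>N. \<forall>m\<ge>N. ell2_norm V (s n - s m) < e / 2"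
      using cau[of "e / 2"] by auto
    have "ell2_norm V (s n - l) < e" if "n \<ge> N" for n
    proof -
      have "ell2_norm V (s n - l) \<le> e / 2"
        using N that e by (intro close[of N]) auto
      then show ?thesis using e by simp
    qed
    then show "\<forall>\<^sub>F n in sequentially. s n \<in> ell2 V \<and> ell2_norm V (s n - l) < e"
      using mem by (auto simp: eventually_sequentially)
  qed
  then show "\<exists>l. limitin (ell2_topology V) s l sequentially"
    by blast
qed

section \<open>Orthogonal complements\<close>

lemma csubspace_orth:
  assumes "M \<subseteq> ell2 V"
  shows "csubspace (orth V M)"
  using assms by (auto simp: cfun.subspace_def orth_def ell2_add ell2_scaleC ell2_inner_add_left
      ell2_inner_scaleC_left subset_iff)

lemma closedin_orth:
  assumes "M \<subseteq> ell2 V"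
  shows "closedin (ell2_topology V) (orth V M)"
  unfolding ell2.closedin_metric
proof (intro conjI allI impI)
  show "orth V M \<subseteq> ell2 V"
    by (auto simp: orth_def)
  fix f assume "f \<in> ell2 V - orth V M"
  then obtain g where f: "f \<in> ell2 V" and g: "g \<in> M" "ell2_inner V f g \<noteq> 0"
    by (auto simp: orth_def)
  have gm: "g \<in> ell2 V"
    using g assms by auto
  have ng: "ell2_norm V g > 0"
    using ell2_norm_eq_0[OF gm] g ell2_norm_nonneg[of V g] by (force simp: less_le)
  define r where "r = cmod (ell2_inner V f g) / ell2_norm V g"
  have "h \<notin> ell2.mball V f r" if h: "h \<in> orth V M" for h
  proof
    assume "h \<in> ell2.mball V f r"
    then have hm: "h \<in> ell2 V" and "ell2_norm V (f - h) < r"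
      by (auto simp: ell2.in_mball)
    then have "ell2_norm V (f - h) * ell2_norm V g < cmod (ell2_inner V f g)"
      using ng by (simp add: r_def field_simps)
    also have "ell2_inner V f g = ell2_inner V (f - h) g"
      using h g f gm hm by (simp add: ell2_inner_diff_left orth_def)
    finally show False
      using ell2_Cauchy_Schwarz[OF ell2_diff[OF f hm] gm] by (simp add: fun_diff_def)
  qed
  then have "disjnt (orth V M) (ell2.mball V f r)"
    by (auto simp: disjnt_def)
  moreover have "r > 0"
    using g ng by (simp add: r_def)
  ultimately show "\<exists>r>0. disjnt (orth V M) (ell2.mball V f r)"
    by blast
qed

text \<open>The projection theorem. Approximations \<open>m n\<close> of \<open>f\<close> from \<open>M\<close> that are nearly optimal leave
  residuals \<open>f - m n\<close> nearly orthogonal to \<open>M\<close>. Since the differences of the approximations lie in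
  \<open>M\<close>, this near orthogonality makes the sequence Cauchy and makes the residual of its limit
  orthogonal to \<open>M\<close>.\<close>

lemma orthogonal_projection_exists:
  assumes M: "csubspace M" "M \<subseteq> ell2 V" and f: "f \<in> ell2 V"
  obtains p where "p \<in> ell2_topology V closure_of M" "f - p \<in> orth V M"
proof -
  define d where "d = (INF m\<in>M. (ell2_norm V (f - m))\<^sup>2)"
  have "0 \<in> M"
    using M by (simp add: cfun.subspace_0)
  have d_le: "d \<le> (ell2_norm V (f - m))\<^sup>2" if "m \<in> M" for m
    unfolding d_def using that by (intro cINF_lower bdd_belowI[of _ 0]) auto
  have "\<exists>m\<in>M. (ell2_norm V (f - m))\<^sup>2 < d + (1 / real (Suc n))\<^sup>2" for n
  proof -
    have "Inf ((\<lambda>m. (ell2_norm V (f - m))\<^sup>2) ` M) < d + (1 / real (Suc n))\<^sup>2"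
      by (simp add: d_def)
    then show ?thesis
      using \<open>0 \<in> M\<close> by (subst (asm) cInf_less_iff) (auto intro!: bdd_belowI[of _ 0])
  qed
  then obtain m where m: "\<And>n. m n \<in> M"
    and m_less: "\<And>n. (ell2_norm V (f - m n))\<^sup>2 < d + (1 / real (Suc n))\<^sup>2"
    by metis
  have mm: "m n \<in> ell2 V" for n
    using m M by auto
  have almost: "cmod (ell2_inner V (f - m n) h) \<le> ell2_norm V h / real (Suc n)" if h: "h \<in> M" for n h
  proof (cases "ell2_norm V h = 0")
    case True
    then have "h = 0"
      using ell2_norm_eq_0 h M by auto
    then show ?thesis by simp
  next
    case False
    then have nh: "ell2_norm V h > 0"
      using ell2_norm_nonneg[of V h] by linarith
    have hm: "h \<in> ell2 V"
      using h M by auto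
    define a where "a = ell2_inner V (f - m n) h"
    (* subtracting c h from m n gives the best approximation of f on the line through m n along h *)
    define c where "c = - (a / of_real ((ell2_norm V h)\<^sup>2))"
    have "m n - scaleC c h \<in> M"
      using M m h by (intro cfun.subspace_diff cfun.subspace_scale) auto
    then have "d \<le> (ell2_norm V (f - (m n - scaleC c h)))\<^sup>2"
      by (rule d_le)
    also have "f - (m n - scaleC c h) = (f - m n) + scaleC c h"
      by simp
    also have "(ell2_norm V \<dots>)\<^sup>2 = (ell2_norm V (f - m n))\<^sup>2 + 2 * Re (cnj c * a) + (cmod c * ell2_norm V h)\<^sup>2"
      using f mm hm by (simp add: ell2_norm_square_add ell2_diff ell2_scaleC ell2_inner_scaleC_right
          ell2_norm_scaleC a_def)
    also have "cnj c * a = - of_real ((cmod a)\<^sup>2 / (ell2_norm V h)\<^sup>2)"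
      by (simp add: c_def mult.commute[of "cnj a"] flip: complex_norm_square)
    also have "(cmod c * ell2_norm V h)\<^sup>2 = (cmod a)\<^sup>2 / (ell2_norm V h)\<^sup>2"
      using nh by (simp add: c_def norm_divide power2_eq_square norm_mult)
    finally have "(cmod a)\<^sup>2 / (ell2_norm V h)\<^sup>2 \<le> (ell2_norm V (f - m n))\<^sup>2 - d"
      by (simp add: fun_diff_def)
    also have "\<dots> \<le> (1 / real (Suc n))\<^sup>2"
      using m_less[of n] by simp
    finally have "(cmod a / ell2_norm V h)\<^sup>2 \<le> (1 / real (Suc n))\<^sup>2"
      by (simp add: power_divide)
    then have "cmod a / ell2_norm V h \<le> 1 / real (Suc n)"
      by (rule power2_le_imp_le) simp
    then show ?thesis
      using nh by (simp add: a_def field_simps)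
  qed
  have diff_le: "ell2_norm V (m n - m k) \<le> 1 / real (Suc n) + 1 / real (Suc k)" for n k
  proof (cases "ell2_norm V (m n - m k) = 0")
    case False
    then have pos: "ell2_norm V (m n - m k) > 0"
      using ell2_norm_nonneg[of V "m n - m k"] by linarith
    define h where "h = m n - m k"
    have h: "h \<in> M" "h \<in> ell2 V"
      using M m by (auto simp: h_def intro: cfun.subspace_diff)
    have "ell2_inner V h h = ell2_inner V ((f - m k) - (f - m n)) h"
      by (rule arg_cong[of _ _ "\<lambda>x. ell2_inner V x h"]) (simp add: h_def)
    also have "\<dots> = ell2_inner V (f - m k) h - ell2_inner V (f - m n) h"
      by (intro ell2_inner_diff_left ell2_diff f mm h)
    finally have "(ell2_norm V h)\<^sup>2 = cmod (ell2_inner V (f - m k) h - ell2_inner V (f - m n) h)"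
      using h by (metis ell2_inner_self abs_power2 norm_of_real)
    also have "\<dots> \<le> ell2_norm V h / real (Suc k) + ell2_norm V h / real (Suc n)"
      using almost[OF h(1)] by (meson add_mono norm_triangle_ineq4 order_trans)
    finally have "ell2_norm V h * ell2_norm V h \<le> ell2_norm V h * (1 / real (Suc n) + 1 / real (Suc k))"
      by (simp add: power2_eq_square algebra_simps)
    then show ?thesis
      using pos by (subst (asm) mult_le_cancel_left_pos) (auto simp: h_def)
  qed simp
  have small: "\<exists>N. \<forall>n\<ge>N. 1 / real (Suc n) < e" if "e > 0" for e
  proof -
    obtain N where "1 / real (Suc N) < e"
      using nat_approx_posE[OF \<open>e > 0\<close>] by blast
    then show ?thesis
      by (meson Suc_le_mono frac_le le_less_trans of_nat_0_less_iff of_nat_mono order_refl zero_le_one zero_less_Suc)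
  qed
  have "ell2.MCauchy V m"
    unfolding ell2.MCauchy_def
  proof (intro conjI allI impI)
    show "range m \<subseteq> ell2 V"
      using mm by auto
    fix e :: real assume "e > 0"
    then obtain N where N: "\<forall>n\<ge>N. 1 / real (Suc n) < e / 2"
      using small[of "e / 2"] by auto
    have "ell2_norm V (m n - m n') < e" if "n \<ge> N" "n' \<ge> N" for n n'
    proof -
      have "1 / real (Suc n) < e / 2" "1 / real (Suc n') < e / 2"
        using N that by blast+
      then show ?thesis
        using diff_le[of n n'] by linarith
    qed
    then show "\<exists>N. \<forall>n n'. N \<le> n \<longrightarrow> N \<le> n' \<longrightarrow> ell2_norm V (m n - m n') < e"
      by blast
  qed
  then obtain p where lim: "limitin (ell2_topology V) m p sequentially"
    using ell2_complete[of V] by (auto simp: ell2.mcomplete_def)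
  then have pm: "p \<in> ell2 V"
    by (simp add: ell2.limitin_metric)
  have to0: "(\<lambda>n. ell2_norm V (m n - p)) \<longlonglongrightarrow> 0"
    using lim by (simp add: ell2.limitin_metric_dist_null)
  have "p \<in> ell2_topology V closure_of M"
    using lim m mm pm unfolding ell2.closure_of_sequentially by blast
  moreover have "f - p \<in> orth V M"
    unfolding orth_def
  proof (intro CollectI conjI ballI ell2_diff f pm)
    fix h assume h: "h \<in> M"
    then have hm: "h \<in> ell2 V"
      using M by auto
    have "cmod (ell2_inner V (f - p) h) \<le> ell2_norm V h * inverse (real (Suc n)) + ell2_norm V (m n - p) * ell2_norm V h" for n
    proof -
      have "f - p = (f - m n) + (m n - p)"
        by simp
      then have "ell2_inner V (f - p) h = ell2_inner V (f - m n) h + ell2_inner V (m n - p) h"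
        using f mm pm hm by (metis ell2_inner_add_left ell2_diff)
      then have "cmod (ell2_inner V (f - p) h) \<le> cmod (ell2_inner V (f - m n) h) + cmod (ell2_inner V (m n - p) h)"
        by (simp add: norm_triangle_ineq)
      also have "\<dots> \<le> ell2_norm V h / real (Suc n) + ell2_norm V (m n - p) * ell2_norm V h"
        using mm pm hm by (intro add_mono almost h ell2_Cauchy_Schwarz ell2_diff)
      finally show ?thesis
        by (simp add: divide_inverse)
    qed
    moreover have "(\<lambda>n. ell2_norm V h * inverse (real (Suc n)) + ell2_norm V (m n - p) * ell2_norm V h)
        \<longlonglongrightarrow> ell2_norm V h * 0 + 0 * ell2_norm V h"
      by (intro tendsto_intros to0 LIMSEQ_inverse_real_of_nat)
    ultimately have "cmod (ell2_inner V (f - p) h) \<le> ell2_norm V h * 0 + 0 * ell2_norm V h"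
      by (intro LIMSEQ_le_const) auto
    then show "ell2_inner V (f - p) h = 0"
      by simp
  qed
  ultimately show thesis
    by (rule that)
qed

lemma orth_closure_span:
  assumes "X \<subseteq> ell2 V"
  shows "orth V (ell2_topology V closure_of cspan X) = orth V X"
proof
  have "X \<subseteq> cspan X"
    by (rule cfun.span_superset)
  moreover have span: "cspan X \<subseteq> ell2 V"
    using assms by (intro cfun.span_minimal) (auto simp: cfun.subspace_def ell2_add ell2_scaleC)
  ultimately have "X \<subseteq> ell2_topology V closure_of cspan X"
    using closure_of_subset[of "cspan X" "ell2_topology V"] by auto
  then show "orth V (ell2_topology V closure_of cspan X) \<subseteq> orth V X"
    by (auto simp: orth_def)
  show "orth V X \<subseteq> orth V (ell2_topology V closure_of cspan X)"
  proof
    fix f assume f: "f \<in> orth V X"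
    then have fm: "{f} \<subseteq> ell2 V"
      by (simp add: orth_def)
    have "X \<subseteq> orth V {f}"
      using f assms by (auto simp: orth_def ell2_inner_commute[of V _ f])
    then have "cspan X \<subseteq> orth V {f}"
      by (intro cfun.span_minimal csubspace_orth fm)
    then have "ell2_topology V closure_of cspan X \<subseteq> orth V {f}"
      by (intro closure_of_minimal closedin_orth fm)
    then show "f \<in> orth V (ell2_topology V closure_of cspan X)"
      using f by (auto simp: orth_def ell2_inner_commute[of V f] subset_iff)
  qed
qed

text \<open>A closed span is determined by its orthogonal complement, so a subspace is a complementary summand
  exactly if it is that complement. The forward direction splits a vector orthogonal to the closed span
  and pairs it with its second component.\<close>

lemma orth_direct_sum_closure_span_iff:
  assumes X: "X \<subseteq> ell2 V" and H: "H \<subseteq> ell2 V"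
  shows "orth_direct_sum V (ell2 V) H (ell2_topology V closure_of cspan X) \<longleftrightarrow> H = orth V X"
proof -
  define N where "N = ell2_topology V closure_of cspan X"
  have orthN: "orth V N = orth V X"
    unfolding N_def using X by (rule orth_closure_span)
  have Nm: "N \<subseteq> ell2 V"
    using closure_of_subset_topspace[of "ell2_topology V" "cspan X"] by (simp add: N_def)
  show ?thesis
    unfolding N_def[symmetric]
  proof
    assume sum: "orth_direct_sum V (ell2 V) H N"
    then have "H \<subseteq> orth V N"
      using H by (auto simp: orth_direct_sum_def orth_def)
    moreover have "orth V N \<subseteq> H"
    proof
      fix f assume f: "f \<in> orth V N"
      then have "f \<in> ell2 V"
        by (simp add: orth_def)
      then obtain a b where ab: "f = a + b" "a \<in> H" "b \<in> N"
        using sum by (auto simp: orth_direct_sum_def)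
      have m: "a \<in> ell2 V" "b \<in> ell2 V"
        using ab H Nm by auto
      have "0 = ell2_inner V f b"
        using f ab by (simp add: orth_def)
      also have "\<dots> = of_real ((ell2_norm V b)\<^sup>2)"
        using ab sum m by (simp add: ell2_inner_add_left ell2_inner_self orth_direct_sum_def)
      finally have "b = 0"
        using ell2_norm_eq_0[OF m(2)] by simp
      then show "f \<in> H"
        using ab by simp
    qed
    ultimately show "H = orth V X"
      using orthN by auto
  next
    assume "H = orth V X"
    then have HN: "H = orth V N"
      using orthN by simp
    show "orth_direct_sum V (ell2 V) H N"
      unfolding orth_direct_sum_def
    proof (intro conjI equalityI subsetI)
      show "\<forall>f\<in>H. \<forall>g\<in>N. ell2_inner V f g = 0"
        using HN by (auto simp: orth_def)
      show "f \<in> ell2 V" if "f \<in> {f + g |f g. f \<in> H \<and> g \<in> N}" for f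
        using that H Nm by (auto intro!: ell2_add)
      fix f assume f: "f \<in> ell2 V"
      have span: "cspan X \<subseteq> ell2 V"
        using X by (intro cfun.span_minimal) (auto simp: cfun.subspace_def ell2_add ell2_scaleC)
      obtain p where p: "p \<in> N" "f - p \<in> orth V (cspan X)"
        using orthogonal_projection_exists[OF cfun.subspace_span span f] by (auto simp: N_def)
      have "orth V (cspan X) \<subseteq> orth V X"
        using cfun.span_superset[of X] by (auto simp: orth_def)
      then have "f - p \<in> H"
        using p HN orthN by auto
      moreover have "f = (f - p) + p"
        by simp
      ultimately show "f \<in> {f + g |f g. f \<in> H \<and> g \<in> N}"
        using p by blast
    qed
  qed
qed

text \<open>The adjoint is defined by a description, so its value is known only once the representing
  vector is shown to exist and to be unique. Existence is the Riesz representation of the functional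
  \<open>g \<mapsto> \<langle>T g, f\<rangle>\<close>: the part of a vector outside its kernel that is orthogonal to the kernel represents it
  up to a scalar.\<close>

lemma adjoint_vector_exists:
  assumes T: "bounded_operator V T" and f: "f \<in> ell2 V"
  shows "\<exists>h\<in>ell2 V. \<forall>g\<in>ell2 V. ell2_inner V (T g) f = ell2_inner V g h"
proof -
  define K where "K = {g \<in> ell2 V. ell2_inner V (T g) f = 0}"
  have Tm: "T g \<in> ell2 V" if "g \<in> ell2 V" for g
    using T that by (simp add: bounded_operator_def)
  have T_add: "T (g + h) = T g + T h" if "g \<in> ell2 V" "h \<in> ell2 V" for g h
    using T that by (simp add: bounded_operator_def)
  have T_scale: "T (scaleC c g) = scaleC c (T g)" if "g \<in> ell2 V" for g c
    using T that by (simp add: bounded_operator_def)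
  have T_diff: "T (g - h) = T g - T h" if "g \<in> ell2 V" "h \<in> ell2 V" for g h
    using T_add[OF ell2_diff[OF that] that(2)] by (simp add: algebra_simps)
  obtain C where C: "\<And>g. g \<in> ell2 V \<Longrightarrow> ell2_norm V (T g) \<le> C * ell2_norm V g"
    using T unfolding bounded_operator_def by blast
  have T0: "T 0 = 0"
    using T_diff[of 0 0] by simp
  have sub: "csubspace K"
    using f by (auto simp: K_def cfun.subspace_def T0 T_add T_scale ell2_add ell2_scaleC ell2_inner_add_left
        ell2_inner_scaleC_left Tm)
  show ?thesis
  proof (cases "K = ell2 V")
    case True
    then show ?thesis
      by (intro bexI[of _ 0]) (auto simp: K_def)
  next
    case False
    then obtain g0 where g0: "g0 \<in> ell2 V" "ell2_inner V (T g0) f \<noteq> 0"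
      by (auto simp: K_def)
    obtain p where p: "p \<in> ell2_topology V closure_of K" and orth: "g0 - p \<in> orth V K"
      using orthogonal_projection_exists[OF sub _ g0(1)] by (auto simp: K_def)
    have pm: "p \<in> ell2 V"
      using p closure_of_subset_topspace[of "ell2_topology V" K] by auto
    have Tp: "ell2_inner V (T p) f = 0"
    proof (rule ccontr)
      assume nz: "ell2_inner V (T p) f \<noteq> 0"
      define b where "b = \<bar>C\<bar> * ell2_norm V f + 1"
      have b: "b > 0"
        by (simp add: b_def add_nonneg_pos)
      define r where "r = cmod (ell2_inner V (T p) f) / b"
      have "r > 0"
        using nz b by (simp add: r_def)
      then obtain k where k: "k \<in> K" and kb: "ell2_norm V (p - k) < r"
        using p unfolding ell2.metric_closure_of by (auto simp: ell2.in_mball)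
      have km: "k \<in> ell2 V"
        using k by (simp add: K_def)
      have "cmod (ell2_inner V (T p) f) = cmod (ell2_inner V (T (p - k)) f)"
        using k km pm f by (simp add: K_def T_diff ell2_inner_diff_left Tm)
      also have "\<dots> \<le> ell2_norm V (T (p - k)) * ell2_norm V f"
        using pm km f by (intro ell2_Cauchy_Schwarz Tm ell2_diff)
      also have "\<dots> \<le> (C * ell2_norm V (p - k)) * ell2_norm V f"
        using pm km by (intro mult_right_mono C ell2_diff) auto
      also have "\<dots> \<le> (\<bar>C\<bar> * ell2_norm V (p - k)) * ell2_norm V f"
        by (intro mult_right_mono) auto
      also have "\<dots> = (\<bar>C\<bar> * ell2_norm V f) * ell2_norm V (p - k)"
        by simp
      also have "\<dots> \<le> b * ell2_norm V (p - k)"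
        by (intro mult_right_mono) (auto simp: b_def)
      also have "\<dots> < b * r"
        using kb b by simp
      finally show False
        using b by (simp add: r_def)
    qed
    define q where "q = g0 - p"
    have qm: "q \<in> ell2 V"
      using g0 pm by (simp add: q_def ell2_diff)
    have Tq: "ell2_inner V (T q) f \<noteq> 0"
      using g0 Tp pm f by (simp add: q_def T_diff ell2_inner_diff_left Tm)
    then have nq: "ell2_norm V q \<noteq> 0"
      using ell2_norm_eq_0[OF qm] T0 by auto
    define h where "h = scaleC (cnj (ell2_inner V (T q) f / of_real ((ell2_norm V q)\<^sup>2))) q"
    have "ell2_inner V (T g) f = ell2_inner V g h" if g: "g \<in> ell2 V" for g
    proof -
      define c where "c = ell2_inner V (T g) f / ell2_inner V (T q) f"
      have "ell2_inner V (T (g - scaleC c q)) f = 0"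
        using g qm f Tq by (simp add: T_diff T_scale ell2_scaleC ell2_inner_diff_left Tm ell2_inner_scaleC_left c_def)
      then have "g - scaleC c q \<in> K"
        using g qm by (simp add: K_def ell2_diff ell2_scaleC)
      then have "ell2_inner V q (g - scaleC c q) = 0"
        using orth by (simp add: orth_def q_def)
      then have "ell2_inner V (g - scaleC c q) q = 0"
        using ell2_inner_commute[of V "g - scaleC c q" q] by simp
      then have "ell2_inner V g q = c * of_real ((ell2_norm V q)\<^sup>2)"
        using g qm by (simp add: ell2_inner_diff_left ell2_scaleC ell2_inner_scaleC_left ell2_inner_self)
      then show ?thesis
        using Tq nq by (simp add: h_def ell2_inner_scaleC_right c_def)
    qed
    moreover have "h \<in> ell2 V"
      using qm by (simp add: h_def ell2_scaleC)
    ultimately show ?thesis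
      by blast
  qed
qed

lemma ker_adjoint_eq_orth_range:
  assumes T: "bounded_operator V T"
  shows "ker V (ell2_adjoint V T) = orth V (T ` ell2 V)"
proof -
  have "ell2_adjoint V T f = 0 \<longleftrightarrow> (\<forall>g\<in>ell2 V. ell2_inner V f (T g) = 0)" if f: "f \<in> ell2 V" for f
  proof -
    obtain h where h: "h \<in> ell2 V" "\<And>g. g \<in> ell2 V \<Longrightarrow> ell2_inner V (T g) f = ell2_inner V g h"
      using adjoint_vector_exists[OF T f] by auto
    have "ell2_adjoint V T f = h"
      unfolding ell2_adjoint_def
    proof (rule the_equality)
      show "h \<in> ell2 V \<and> (\<forall>g\<in>ell2 V. ell2_inner V (T g) f = ell2_inner V g h)"
        using h by blast
      fix h' assume h': "h' \<in> ell2 V \<and> (\<forall>g\<in>ell2 V. ell2_inner V (T g) f = ell2_inner V g h')"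
      have "ell2_inner V (h' - h) (h' - h) = ell2_inner V (h' - h) h' - ell2_inner V (h' - h) h"
        using h h' by (simp add: ell2_inner_diff_right ell2_diff)
      also have "\<dots> = 0"
        using h h' by (metis ell2_diff eq_iff_diff_eq_0)
      finally have "h' - h = 0"
        using ell2_norm_eq_0[OF ell2_diff, of h' V h] h h' by (simp add: ell2_inner_self ell2_diff)
      then show "h' = h"
        by simp
    qed
    moreover have "h = 0 \<longleftrightarrow> (\<forall>g\<in>ell2 V. ell2_inner V g h = 0)"
      using h ell2_norm_eq_0[of h V] by (auto simp: ell2_inner_self dest!: bspec[of _ _ h])
    moreover have "ell2_inner V g h = 0 \<longleftrightarrow> ell2_inner V f (T g) = 0" if "g \<in> ell2 V" for g
      using h(2)[OF that] ell2_inner_commute[of V f "T g"] by simp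
    ultimately show ?thesis
      by auto
  qed
  then show ?thesis
    by (auto simp: ker_def orth_def)
qed

section \<open>Rootless leafless trees\<close>

locale rootless_leafless_tree =
  fixes V :: "'v set" and E :: "('v \<times> 'v) set"
  assumes tree: "directed_tree V E" and rootless: "rootless V E" and leafless: "leafless V E"
begin

lemma edge_iff: "(u, v) \<in> E \<longleftrightarrow> v \<in> V \<and> u = par E v"
proof -
  have unique: "u = u'" if "(u, v) \<in> E" "(u', v) \<in> E" for u u' v
    using tree that by (auto simp: directed_tree_def)
  have par: "(par E v, v) \<in> E" if v: "v \<in> V" for v
  proof -
    obtain u where "(u, v) \<in> E"
      using rootless v by (auto simp: rootless_def)
    then show ?thesis
      unfolding par_def by (rule theI) (use \<open>(u, v) \<in> E\<close> unique in blast)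
  qed
  have "E \<subseteq> V \<times> V"
    using tree by (simp add: directed_tree_def)
  then show ?thesis
    using par unique by blast
qed

lemma par_in [simp, intro]: "v \<in> V \<Longrightarrow> par E v \<in> V"
  using edge_iff[of "par E v" v] tree by (auto simp: directed_tree_def)

lemma funpow_par_in [simp, intro]: "v \<in> V \<Longrightarrow> (par E ^^ n) v \<in> V"
  by (induction n) auto

lemma Chi_eq: "Chi E W = {v \<in> V. par E v \<in> W}"
  by (auto simp: Chi_def edge_iff)

lemma child_exists:
  assumes "u \<in> V"
  obtains v where "v \<in> V" "par E v = u"
  using leafless assms by (auto simp: leafless_def Chi_eq)

lemma child_selection:
  obtains ch where "\<And>u. u \<in> V \<Longrightarrow> ch u \<in> V" "\<And>u. u \<in> V \<Longrightarrow> par E (ch u) = u"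
proof -
  have "\<forall>u\<in>V. \<exists>w. w \<in> V \<and> par E w = u"
    using child_exists by blast
  then obtain ch where "\<forall>u\<in>V. ch u \<in> V \<and> par E (ch u) = u"
    by (auto dest!: bchoice)
  then show thesis
    by (intro that[of ch]) auto
qed

lemma funpow_Chi_eq: "x \<in> V \<Longrightarrow> (Chi E ^^ n) {x} = {v \<in> V. (par E ^^ n) v = x}"
  by (induction n) (auto simp: Chi_eq funpow_swap1)

lemma funpow_par_eq_mono:
  assumes "(par E ^^ m) u = (par E ^^ m) v" "m \<le> n"
  shows "(par E ^^ n) u = (par E ^^ n) v"
proof -
  obtain k where "n = k + m"
    using assms(2) by (metis le_add_diff_inverse2)
  then show ?thesis
    using assms(1) by (simp add: funpow_add)
qed

lemma same_generation_refl [simp]: "same_generation E u u"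
  by (simp add: same_generation_def)

lemma same_generation_sym: "same_generation E u v \<Longrightarrow> same_generation E v u"
  unfolding same_generation_def by metis

lemma same_generation_common:
  assumes "same_generation E u v" "same_generation E v w"
  obtains n where "(par E ^^ n) u = (par E ^^ n) v" "(par E ^^ n) v = (par E ^^ n) w"
proof -
  obtain k m where "(par E ^^ k) u = (par E ^^ k) v" "(par E ^^ m) v = (par E ^^ m) w"
    using assms by (auto simp: same_generation_def)
  then show thesis
    by (intro that[of "max k m"]) (auto elim: funpow_par_eq_mono)
qed

lemma same_generation_trans:
  assumes "same_generation E u v" "same_generation E v w"
  shows "same_generation E u w"
  using same_generation_common[OF assms] by (metis same_generation_def)

lemma same_generation_par_iff [simp]:
  "same_generation E (par E u) (par E v) \<longleftrightarrow> same_generation E u v"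
proof
  assume "same_generation E (par E u) (par E v)"
  then obtain n where "(par E ^^ Suc n) u = (par E ^^ Suc n) v"
    by (auto simp: same_generation_def funpow_swap1)
  then show "same_generation E u v"
    unfolding same_generation_def by blast
next
  assume "same_generation E u v"
  then obtain n where "(par E ^^ n) u = (par E ^^ n) v"
    by (auto simp: same_generation_def)
  then have "(par E ^^ n) (par E u) = (par E ^^ n) (par E v)"
    by (simp flip: funpow_swap1)
  then show "same_generation E (par E u) (par E v)"
    unfolding same_generation_def by blast
qed

text \<open>Connectedness of the tree in the form in which it is used throughout.\<close>

lemma invariant_along_edges:
  assumes step: "\<And>v. v \<in> V \<Longrightarrow> P (par E v) \<longleftrightarrow> P v" and "u \<in> V" "v \<in> V"
  shows "P u \<longleftrightarrow> P v"
proof -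
  have "(u, v) \<in> (E \<union> E\<inverse>)\<^sup>*"
    using tree assms by (simp add: directed_tree_def)
  then show ?thesis
  proof induction
    case (step y z)
    then have "y \<in> V \<and> z = par E y \<or> z \<in> V \<and> y = par E z"
      by (auto simp: edge_iff)
    then have "P y \<longleftrightarrow> P z"
      using assms(1)[of y] assms(1)[of z] by (elim disjE conjE) simp_all
    then show ?case
      using step.IH by simp
  qed simp
qed

text \<open>The \<open>n\<close>-th layer consists of the vertices whose first common ancestor with \<open>v\<close> lies \<open>n\<close> generations up.
  The second conjunct excludes vertices without any common ancestor, for which the least number is an
  arbitrary default value.\<close>

lemma gen_layer_eq:
  assumes "v \<in> V"
  shows "gen_layer E v n = {u \<in> V. (LEAST k. (par E ^^ k) u = (par E ^^ k) v) = n \<and> (par E ^^ n) u = (par E ^^ n) v}"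
proof (cases n)
  case 0
  then show ?thesis
    using assms by (auto intro!: Least_eq_0)
next
  case (Suc m)
  have "gen_layer E v n = {u \<in> V. (par E ^^ n) u = (par E ^^ n) v \<and> (par E ^^ m) u \<noteq> (par E ^^ m) v}"
    unfolding Suc gen_layer.simps using assms
    by (subst funpow_Chi_eq, simp, subst funpow_Chi_eq) auto
  moreover have "(LEAST k. (par E ^^ k) u = (par E ^^ k) v) = n \<longleftrightarrow> (par E ^^ m) u \<noteq> (par E ^^ m) v"
    if n: "(par E ^^ n) u = (par E ^^ n) v" for u
  proof -
    define l where "l = (LEAST k. (par E ^^ k) u = (par E ^^ k) v)"
    have l: "(par E ^^ l) u = (par E ^^ l) v"
      unfolding l_def using n by (rule LeastI)
    have "l \<le> k" if "(par E ^^ k) u = (par E ^^ k) v" for k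
      unfolding l_def using that by (rule Least_le)
    then have "(par E ^^ m) u = (par E ^^ m) v \<longleftrightarrow> l \<le> m" "l \<le> Suc m"
      using funpow_par_eq_mono[OF l, of m] n unfolding Suc by blast+
    then have "l = n \<longleftrightarrow> (par E ^^ m) u \<noteq> (par E ^^ m) v"
      unfolding Suc by linarith
    then show ?thesis
      by (simp add: l_def)
  qed
  ultimately show ?thesis
    by auto
qed

lemma bilateral_path_in:
  assumes "bilateral_path V E p"
  shows "p m \<in> V"
proof (cases "m \<le> -1")
  case True
  then show ?thesis
    using assms by (auto simp: bilateral_path_def)
next
  case False
  then show ?thesis
    using assms by (cases "m = 0") (auto simp: bilateral_path_def Chi_eq)
qed

lemma par_bilateral_path:
  assumes p: "bilateral_path V E p"
  shows "par E (p (m + 1)) = p m"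
proof (cases "m \<ge> 0")
  case True
  then have "p (m + 1) \<in> Chi E {p m}"
    using p by (auto simp: bilateral_path_def dest!: spec[of _ "m + 1"])
  then show ?thesis
    by (simp add: Chi_eq)
next
  case False
  have "p (m + 1) = (par E ^^ nat (- (m + 1))) (p 0)"
    using p False by (cases "m = -1") (auto simp: bilateral_path_def)
  moreover have "p m = (par E ^^ nat (- m)) (p 0)"
    using p False by (auto simp: bilateral_path_def)
  moreover have "nat (- m) = Suc (nat (- (m + 1)))"
    using False by simp
  ultimately show ?thesis
    by simp
qed

text \<open>Passing to the parent moves a generation one step, and the path can be followed by one step in
  either direction; so the vertices whose generation meets the path are closed under both.\<close>

lemma bilateral_path_meets_generation:
  assumes p: "bilateral_path V E p" and v: "v \<in> V"
  obtains m where "same_generation E (p m) v"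
proof -
  define P where "P u \<longleftrightarrow> (\<exists>m. same_generation E (p m) u)" for u
  have "P (par E u) \<longleftrightarrow> P u" for u
    unfolding P_def by (metis par_bilateral_path[OF p] same_generation_par_iff diff_add_cancel)
  then have "P v \<longleftrightarrow> P (p 0)"
    using v bilateral_path_in[OF p] by (rule invariant_along_edges)
  moreover have "P (p 0)"
    unfolding P_def using same_generation_refl by blast
  ultimately have "\<exists>m. same_generation E (p m) v"
    by (simp add: P_def)
  then show thesis
    using that by blast
qed

lemma bilateral_path_exists:
  assumes "V \<noteq> {}"
  shows "\<exists>p. bilateral_path V E p"
proof -
  obtain v where v: "v \<in> V"
    using assms by blast
  obtain ch where ch: "\<And>u. u \<in> V \<Longrightarrow> ch u \<in> V" "\<And>u. u \<in> V \<Longrightarrow> par E (ch u) = u"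
    using child_selection by blast
  have chV: "(ch ^^ n) v \<in> V" for n
    by (induction n) (auto simp: v ch)
  define p where "p m = (if m \<ge> 0 then (ch ^^ nat m) v else (par E ^^ nat (- m)) v)" for m
  have "p m \<in> Chi E {p (m - 1)}" if "m \<ge> 1" for m
  proof -
    have "nat m = Suc (nat (m - 1))"
      using that by simp
    then have "p m = ch (p (m - 1))"
      using that by (simp add: p_def)
    moreover have "p (m - 1) \<in> V"
      using that chV by (simp add: p_def)
    ultimately show ?thesis
      using ch by (simp add: Chi_eq)
  qed
  then have "bilateral_path V E p"
    using v by (auto simp: bilateral_path_def p_def)
  then show ?thesis
    by blast
qed

text \<open>Every vertex is a child of exactly one vertex, so summation over the vertices may be carried
  out over the sibling sets first.\<close>

lemma bij_betw_children: "bij_betw snd (Sigma V (\<lambda>u. Chi E {u})) V"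
  by (rule bij_betwI[of _ _ _ "\<lambda>v. (par E v, v)"]) (auto simp: Chi_eq)

lemma
  fixes \<phi> :: "'v \<Rightarrow> complex" and r :: "'v \<Rightarrow> real"
  assumes r: "\<And>v. v \<in> V \<Longrightarrow> r v \<ge> 0" "\<And>u. u \<in> V \<Longrightarrow> r summable_on Chi E {u}"
  shows summable_children_iff:
    "(\<lambda>v. norm (of_real (r v) * \<phi> (par E v))) summable_on V \<longleftrightarrow>
      (\<lambda>u. infsum r (Chi E {u}) * norm (\<phi> u)) summable_on V" (is ?summable)
    and infsum_children:
    "(\<lambda>v. norm (of_real (r v) * \<phi> (par E v))) summable_on V \<Longrightarrow>
      (\<Sum>\<^sub>\<infinity>v\<in>V. of_real (r v) * \<phi> (par E v)) = (\<Sum>\<^sub>\<infinity>u\<in>V. of_real (infsum r (Chi E {u})) * \<phi> u)"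
proof -
  define f where "f = (\<lambda>(u, v). complex_of_real (r v) * \<phi> u)"
  let ?S = "Sigma V (\<lambda>u. Chi E {u})"
  have f: "complex_of_real (r (snd x)) * \<phi> (par E (snd x)) = f x" if "x \<in> ?S" for x
    using that by (auto simp: f_def Chi_eq)
  have r0: "r v \<ge> 0" if "v \<in> Chi E {u}" for u v
    using r(1) that by (auto simp: Chi_eq)
  have norm_inner: "(\<Sum>\<^sub>\<infinity>v\<in>Chi E {u}. norm (f (u, v))) = infsum r (Chi E {u}) * norm (\<phi> u)" for u
  proof -
    have "(\<Sum>\<^sub>\<infinity>v\<in>Chi E {u}. norm (f (u, v))) = (\<Sum>\<^sub>\<infinity>v\<in>Chi E {u}. r v * norm (\<phi> u))"
      using r0 by (intro infsum_cong) (auto simp: f_def norm_mult)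
    then show ?thesis
      by (simp add: infsum_cmult_left')
  qed
  have norm_summable: "(\<lambda>v. norm (f (u, v))) summable_on Chi E {u}" if "u \<in> V" for u
  proof -
    have "(\<lambda>v. r v * norm (\<phi> u)) summable_on Chi E {u}"
      using r(2)[OF that] by (rule summable_on_cmult_left)
    then show ?thesis
      using r0 by (elim summable_on_cong[THEN iffD1, rotated]) (auto simp: f_def norm_mult)
  qed
  have iff: "(\<lambda>v. norm (of_real (r v) * \<phi> (par E v))) summable_on V \<longleftrightarrow> (\<lambda>x. norm (f x)) summable_on ?S"
  proof -
    have "(\<lambda>v. norm (of_real (r v) * \<phi> (par E v))) summable_on V \<longleftrightarrow>
        (\<lambda>x. norm (of_real (r (snd x)) * \<phi> (par E (snd x)))) summable_on ?S"
      by (rule summable_on_reindex_bij_betw[OF bij_betw_children, symmetric])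
    also have "\<dots> \<longleftrightarrow> (\<lambda>x. norm (f x)) summable_on ?S"
      using f by (intro summable_on_cong) auto
    finally show ?thesis .
  qed
  have nonneg: "infsum r (Chi E {u}) * norm (\<phi> u) \<ge> 0" for u
    using r0 by (intro mult_nonneg_nonneg infsum_nonneg) auto
  show ?summable
    unfolding iff Infinite_Sum.abs_summable_on_Sigma_iff norm_inner real_norm_def abs_of_nonneg[OF nonneg]
    using norm_summable by auto
  assume "(\<lambda>v. norm (of_real (r v) * \<phi> (par E v))) summable_on V"
  then have "f summable_on ?S"
    unfolding iff by (rule abs_summable_summable)
  then have "infsum f ?S = (\<Sum>\<^sub>\<infinity>u\<in>V. \<Sum>\<^sub>\<infinity>v\<in>Chi E {u}. f (u, v))"
    by (rule infsum_Sigma_banach[symmetric])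
  also have "\<dots> = (\<Sum>\<^sub>\<infinity>u\<in>V. of_real (infsum r (Chi E {u})) * \<phi> u)"
  proof (rule infsum_cong)
    fix u assume "u \<in> V"
    then have "((\<lambda>v. complex_of_real (r v)) has_sum of_real (infsum r (Chi E {u}))) (Chi E {u})"
      using r by (intro has_sum_of_real has_sum_infsum)
    then show "(\<Sum>\<^sub>\<infinity>v\<in>Chi E {u}. f (u, v)) = of_real (infsum r (Chi E {u})) * \<phi> u"
      by (simp add: f_def infsum_cmult_left' infsumI)
  qed
  finally have "infsum f ?S = (\<Sum>\<^sub>\<infinity>u\<in>V. of_real (infsum r (Chi E {u})) * \<phi> u)" .
  moreover have "(\<Sum>\<^sub>\<infinity>v\<in>V. of_real (r v) * \<phi> (par E v)) = infsum f ?S"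
    using f by (subst infsum_reindex_bij_betw[OF bij_betw_children, symmetric]) (auto intro!: infsum_cong)
  ultimately show "(\<Sum>\<^sub>\<infinity>v\<in>V. of_real (r v) * \<phi> (par E v)) = (\<Sum>\<^sub>\<infinity>u\<in>V. of_real (infsum r (Chi E {u})) * \<phi> u)"
    by simp
qed

lemma wshift_indicator:
  assumes "u \<in> V"
  shows "wshift V E mu (indicator {u}) = (\<lambda>v. if v \<in> Chi E {u} then of_real (mu v) else 0)"
  by (auto simp: wshift_def Chi_eq indicator_def fun_eq_iff)

lemma ell2_norm_wshift_indicator:
  assumes "u \<in> V"
  shows "(ell2_norm V (wshift V E mu (indicator {u})))\<^sup>2 = (\<Sum>\<^sub>\<infinity>v\<in>Chi E {u}. (mu v)\<^sup>2)"
  unfolding ell2_norm_square wshift_indicator[OF assms]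
  by (rule infsum_cong_neutral) (auto simp: Chi_eq)

lemma wshift_indicator_in_ell2_iff:
  assumes "u \<in> V"
  shows "wshift V E mu (indicator {u}) \<in> ell2 V \<longleftrightarrow> (\<lambda>v. (mu v)\<^sup>2) summable_on Chi E {u}"
proof -
  have "(\<lambda>v. (cmod (if v \<in> Chi E {u} then of_real (mu v) else 0))\<^sup>2) summable_on V \<longleftrightarrow>
      (\<lambda>v. (mu v)\<^sup>2) summable_on Chi E {u}"
    by (rule summable_on_cong_neutral) (auto simp: Chi_eq)
  then show ?thesis
    unfolding wshift_indicator[OF assms] by (auto simp: ell2_def Chi_eq)
qed

lemma wpow_Suc: "wpow E mu (Suc n) v = mu v * wpow E mu n (par E v)"
  by (simp add: wpow_def prod.lessThan_Suc_shift funpow_swap1 o_def del: prod.lessThan_Suc)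

lemma wpow_add: "wpow E mu (m + n) v = wpow E mu m v * wpow E mu n ((par E ^^ m) v)"
  by (induction m arbitrary: v) (simp_all add: wpow_Suc funpow_swap1, simp add: wpow_def)

lemma wpow_0 [simp]: "wpow E mu 0 v = 1"
  by (simp add: wpow_def)

lemma wshift_funpow:
  assumes "v \<in> V"
  shows "(wshift V E mu ^^ n) f v = of_real (wpow E mu n v) * f ((par E ^^ n) v)"
  using assms
proof (induction n arbitrary: v)
  case (Suc n)
  then show ?case
    by (simp add: wshift_def wpow_Suc funpow_swap1)
qed simp

end

section \<open>Sums over disjoint layers\<close>

text \<open>Sums of extended nonnegative reals are suprema of finite sums, and a finite subset of the union
  already lies in the union of finitely many of the sets.\<close>

lemma suminf_infsum_ennreal:
  fixes F :: "'a \<Rightarrow> ennreal"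
  assumes disj: "disjoint_family L"
  shows "(\<Sum>n. infsum F (L n)) = infsum F (\<Union>n. L n)"
proof (rule antisym)
  have partial: "(\<Sum>n<N. infsum F (L n)) = infsum F (\<Union>n<N. L n)" for N
  proof (induction N)
    case (Suc N)
    have "L n \<inter> L N = {}" if "n < N" for n
      using that by (intro disjoint_family_onD[OF disj]) auto
    then have "(\<Union>n<N. L n) \<inter> L N = {}"
      by blast
    then have "infsum F ((\<Union>n<N. L n) \<union> L N) = infsum F (\<Union>n<N. L n) + infsum F (L N)"
      by (intro infsum_Un_disjoint nonneg_summable_on_complete zero_le)
    then show ?case
      by (simp add: Suc lessThan_Suc Un_commute)
  qed simp
  show "(\<Sum>n. infsum F (L n)) \<le> infsum F (\<Union>n. L n)"
  proof (rule suminf_le_const)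
    show "(\<Sum>n<N. infsum F (L n)) \<le> infsum F (\<Union>n. L n)" for N
      unfolding partial by (rule infsum_mono_neutral) (auto intro: nonneg_summable_on_complete)
  qed auto
  show "infsum F (\<Union>n. L n) \<le> (\<Sum>n. infsum F (L n))"
    unfolding nonneg_infsum_complete[of "\<Union>n. L n" F, OF zero_le]
  proof (rule SUP_least, clarify)
    fix G assume "finite G" "G \<subseteq> (\<Union>n. L n)"
    then obtain J where "finite J" "G \<subseteq> (\<Union>n\<in>J. L n)"
      using finite_subset_Union[of G "range L"] by (metis finite_subset_image)
    moreover obtain N where "J \<subseteq> {..<N}"
      using finite_nat_bounded[OF \<open>finite J\<close>] by blast
    ultimately have N: "G \<subseteq> (\<Union>n<N. L n)"
      by blast
    then have "sum F G \<le> infsum F (\<Union>n<N. L n)"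
      using \<open>finite G\<close> by (subst nonneg_infsum_complete) (auto intro!: SUP_upper)
    also have "\<dots> \<le> (\<Sum>n. infsum F (L n))"
      unfolding partial[symmetric] by (rule sum_le_suminf) auto
    finally show "sum F G \<le> (\<Sum>n. infsum F (L n))" .
  qed
qed

section \<open>Weighted shifts that are bounded above and below\<close>

text \<open>The constants \<open>c\<close> and \<open>C\<close> bound \<open>\<parallel>S e\<^sub>u\<parallel>\<^sup>2\<close> from below and above. They stand for left invertibility and
  boundedness of the shift, and unlike these they pass visibly to the Cauchy dual, where they become
  \<open>1 / C\<close> and \<open>1 / c\<close>.\<close>

locale weighted_tree = rootless_leafless_tree V E
  for V :: "'v set" and E :: "('v \<times> 'v) set" +
  fixes mu :: "'v \<Rightarrow> real" and c C :: real
  assumes weight_pos: "v \<in> V \<Longrightarrow> mu v > 0"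
    and weights_summable: "u \<in> V \<Longrightarrow> (\<lambda>v. (mu v)\<^sup>2) summable_on Chi E {u}"
    and lower_pos: "c > 0" and upper_pos: "C > 0"
    and lower: "u \<in> V \<Longrightarrow> c \<le> (\<Sum>\<^sub>\<infinity>v\<in>Chi E {u}. (mu v)\<^sup>2)"
    and upper: "u \<in> V \<Longrightarrow> (\<Sum>\<^sub>\<infinity>v\<in>Chi E {u}. (mu v)\<^sup>2) \<le> C"
begin

abbreviation "S \<equiv> wshift V E mu"

definition child_mass :: "'v \<Rightarrow> real" where
  "child_mass u = (\<Sum>\<^sub>\<infinity>v\<in>Chi E {u}. (mu v)\<^sup>2)"

lemma child_mass_pos: "u \<in> V \<Longrightarrow> child_mass u > 0"
  using lower lower_pos unfolding child_mass_def by fastforce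

lemma child_mass_eq_norm: "u \<in> V \<Longrightarrow> child_mass u = (ell2_norm V (S (indicator {u})))\<^sup>2"
  by (simp add: ell2_norm_wshift_indicator child_mass_def)

lemma wshift_add: "S (f + g) = S f + S g"
  by (auto simp: wshift_def fun_eq_iff algebra_simps)

lemma wshift_scaleC: "S (scaleC a f) = scaleC a (S f)"
  by (auto simp: wshift_def scaleC_def fun_eq_iff)

lemma wshift_square_summable_iff:
  "(\<lambda>v. (cmod (S f v))\<^sup>2) summable_on V \<longleftrightarrow> (\<lambda>u. child_mass u * (cmod (f u))\<^sup>2) summable_on V"
proof -
  have "(\<lambda>v. (cmod (S f v))\<^sup>2) summable_on V \<longleftrightarrow>
      (\<lambda>v. norm (of_real ((mu v)\<^sup>2) * complex_of_real ((cmod (f (par E v)))\<^sup>2))) summable_on V"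
    by (intro summable_on_cong) (auto simp: wshift_def norm_mult power_mult_distrib norm_power)
  then show ?thesis
    using summable_children_iff[of "\<lambda>v. (mu v)\<^sup>2" "\<lambda>u. complex_of_real ((cmod (f u))\<^sup>2)"]
    by (simp add: weights_summable child_mass_def norm_power)
qed

text \<open>Boundedness of the shift from above and below, as a statement about square summability. The second
  direction yields square summable preimages of functions in the range.\<close>

lemma wshift_in_ell2_iff:
  assumes "\<And>v. v \<notin> V \<Longrightarrow> f v = 0"
  shows "S f \<in> ell2 V \<longleftrightarrow> f \<in> ell2 V"
proof -
  have "(\<lambda>u. child_mass u * (cmod (f u))\<^sup>2) summable_on V \<longleftrightarrow> (\<lambda>u. (cmod (f u))\<^sup>2) summable_on V"
  proof
    assume "(\<lambda>u. child_mass u * (cmod (f u))\<^sup>2) summable_on V"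
    then have "(\<lambda>u. 1 / c * (child_mass u * (cmod (f u))\<^sup>2)) summable_on V"
      by (rule summable_on_cmult_right)
    moreover have "(cmod (f u))\<^sup>2 \<le> 1 / c * (child_mass u * (cmod (f u))\<^sup>2)" if "u \<in> V" for u
    proof -
      have "c * (cmod (f u))\<^sup>2 \<le> child_mass u * (cmod (f u))\<^sup>2"
        using lower[OF that] by (intro mult_right_mono) (auto simp: child_mass_def)
      then show ?thesis
        using lower_pos by (simp add: field_simps)
    qed
    ultimately show "(\<lambda>u. (cmod (f u))\<^sup>2) summable_on V"
      by (rule summable_on_comparison_test) auto
  next
    assume "(\<lambda>u. (cmod (f u))\<^sup>2) summable_on V"
    then have "(\<lambda>u. C * (cmod (f u))\<^sup>2) summable_on V"
      by (rule summable_on_cmult_right)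
    moreover have "child_mass u * (cmod (f u))\<^sup>2 \<le> C * (cmod (f u))\<^sup>2" if "u \<in> V" for u
      using upper[OF that] by (intro mult_right_mono) (auto simp: child_mass_def)
    ultimately show "(\<lambda>u. child_mass u * (cmod (f u))\<^sup>2) summable_on V"
      by (rule summable_on_comparison_test) (auto intro!: mult_nonneg_nonneg less_imp_le[OF child_mass_pos])
  qed
  then show ?thesis
    using assms wshift_square_summable_iff[of f] by (auto simp: ell2_def wshift_def)
qed

lemma wshift_in_ell2: "f \<in> ell2 V \<Longrightarrow> S f \<in> ell2 V"
  using wshift_in_ell2_iff[of f] by (simp add: ell2_def)

lemma wshift_funpow_in_ell2: "f \<in> ell2 V \<Longrightarrow> (S ^^ n) f \<in> ell2 V"
  by (induction n) (auto intro: wshift_in_ell2)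

lemma ell2_norm_wshift:
  assumes "f \<in> ell2 V"
  shows "(ell2_norm V (S f))\<^sup>2 = (\<Sum>\<^sub>\<infinity>u\<in>V. child_mass u * (cmod (f u))\<^sup>2)"
proof -
  have "(\<lambda>v. (cmod (S f v))\<^sup>2) summable_on V"
    using wshift_in_ell2[OF assms] by (simp add: ell2_def)
  then have summable: "(\<lambda>v. norm (of_real ((mu v)\<^sup>2) * complex_of_real ((cmod (f (par E v)))\<^sup>2))) summable_on V"
    by (elim summable_on_cong[THEN iffD1, rotated]) (auto simp: wshift_def norm_mult power_mult_distrib norm_power)
  have sum_f: "(\<lambda>u. child_mass u * (cmod (f u))\<^sup>2) summable_on V"
    using wshift_in_ell2[OF assms] wshift_square_summable_iff[of f] by (simp add: ell2_def)
  have "complex_of_real ((ell2_norm V (S f))\<^sup>2) = (\<Sum>\<^sub>\<infinity>v\<in>V. of_real ((cmod (S f v))\<^sup>2))"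
    unfolding ell2_norm_square using wshift_in_ell2[OF assms]
    by (intro infsumI[symmetric] has_sum_of_real has_sum_infsum) (simp add: ell2_def)
  also have "\<dots> = (\<Sum>\<^sub>\<infinity>v\<in>V. of_real ((mu v)\<^sup>2) * complex_of_real ((cmod (f (par E v)))\<^sup>2))"
    by (intro infsum_cong) (auto simp: wshift_def norm_mult power_mult_distrib)
  also have "\<dots> = (\<Sum>\<^sub>\<infinity>u\<in>V. of_real (child_mass u) * complex_of_real ((cmod (f u))\<^sup>2))"
    unfolding child_mass_def
    by (rule infsum_children[OF _ weights_summable summable]) auto
  also have "\<dots> = (\<Sum>\<^sub>\<infinity>u\<in>V. of_real (child_mass u * (cmod (f u))\<^sup>2))"
    by simp
  also have "\<dots> = of_real (\<Sum>\<^sub>\<infinity>u\<in>V. child_mass u * (cmod (f u))\<^sup>2)"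
    by (intro infsumI has_sum_of_real has_sum_infsum sum_f)
  finally show ?thesis
    by (simp only: of_real_eq_iff)
qed

lemma bounded_wshift: "bounded_operator V S"
proof -
  have "ell2_norm V (S f) \<le> sqrt C * ell2_norm V f" if f: "f \<in> ell2 V" for f
  proof -
    have sf: "(\<lambda>u. (cmod (f u))\<^sup>2) summable_on V"
      using f by (simp add: ell2_def)
    have "(\<lambda>v. (cmod (S f v))\<^sup>2) summable_on V"
      using wshift_in_ell2[OF f] by (simp add: ell2_def)
    then have "(\<lambda>u. child_mass u * (cmod (f u))\<^sup>2) summable_on V"
      by (simp only: wshift_square_summable_iff)
    then have "(\<Sum>\<^sub>\<infinity>u\<in>V. child_mass u * (cmod (f u))\<^sup>2) \<le> (\<Sum>\<^sub>\<infinity>u\<in>V. C * (cmod (f u))\<^sup>2)"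
      using upper by (intro infsum_mono summable_on_cmult_right sf mult_right_mono) (auto simp: child_mass_def)
    also have "\<dots> = C * (ell2_norm V f)\<^sup>2"
      by (simp add: infsum_cmult_right' ell2_norm_square)
    finally have "(ell2_norm V (S f))\<^sup>2 \<le> (sqrt C * ell2_norm V f)\<^sup>2"
      using upper_pos by (simp add: ell2_norm_wshift[OF f] power_mult_distrib)
    then show ?thesis
      by (rule power2_le_imp_le) (use upper_pos in simp)
  qed
  then show ?thesis
    unfolding bounded_operator_def
    by (intro conjI exI[of _ "sqrt C"] ballI allI wshift_in_ell2 wshift_add wshift_scaleC)
qed

lemma balanced_iff:
  "balanced V E mu \<longleftrightarrow> (\<forall>u\<in>V. \<forall>v\<in>V. same_generation E u v \<longrightarrow> child_mass u = child_mass v)"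
  by (auto simp: balanced_def child_mass_eq_norm)

lemma wpow_pos: "v \<in> V \<Longrightarrow> wpow E mu n v > 0"
  by (auto simp: wpow_def intro!: prod_pos weight_pos)

text \<open>Above a common ancestor both products acquire the same factors.\<close>

lemma wpow_ratio_eq:
  assumes uv: "u \<in> V" "v \<in> V" and m: "(par E ^^ m) u = (par E ^^ m) v" and n: "(par E ^^ n) u = (par E ^^ n) v"
  shows "wpow E mu m u / wpow E mu m v = wpow E mu n u / wpow E mu n v"
proof -
  have *: "wpow E mu k u / wpow E mu k v = wpow E mu (k + j) u / wpow E mu (k + j) v"
    if "(par E ^^ k) u = (par E ^^ k) v" for k j
    using wpow_pos[of "(par E ^^ k) v" j] uv that by (simp add: wpow_add)
  show ?thesis
  proof (cases "m \<le> n")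
    case True
    then show ?thesis
      using *[OF m, of "n - m"] by simp
  next
    case False
    then show ?thesis
      using *[OF n, of "m - n"] by simp
  qed
qed

section \<open>Coherent functions and the hyper-range\<close>

text \<open>A square summable function lies in the range of \<open>S\<^sup>n\<close> exactly if its quotient by the weight product of length
  \<open>n\<close> depends only on the \<open>n\<close>-th ancestor. Coherent functions have this property for all \<open>n\<close>.\<close>

definition coherent :: "('v \<Rightarrow> complex) set" where
  "coherent = {f \<in> ell2 V. \<forall>n. \<forall>u\<in>V. \<forall>v\<in>V. (par E ^^ n) u = (par E ^^ n) v \<longrightarrow>
     f u * of_real (wpow E mu n v) = f v * of_real (wpow E mu n u)}"

lemma coherent_subset: "coherent \<subseteq> ell2 V"
  by (auto simp: coherent_def)

lemma coherentD:
  assumes "f \<in> coherent" "u \<in> V" "v \<in> V" "(par E ^^ n) u = (par E ^^ n) v"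
  shows "f u * of_real (wpow E mu n v) = f v * of_real (wpow E mu n u)"
  using assms unfolding coherent_def by blast

text \<open>For the preimage the value at a vertex is read off at a selected child; coherence for \<open>n = 1\<close> makes
  it independent of the selection.\<close>

lemma wshift_image_coherent: "S ` coherent = coherent"
proof (intro equalityI subsetI)
  fix h assume "h \<in> S ` coherent"
  then obtain f where f: "f \<in> coherent" and h: "h = S f"
    by blast
  have "h u * of_real (wpow E mu n v) = h v * of_real (wpow E mu n u)"
    if uv: "u \<in> V" "v \<in> V" "(par E ^^ n) u = (par E ^^ n) v" for n u v
  proof (cases n)
    case (Suc m)
    then have "f (par E u) * of_real (wpow E mu m (par E v)) = f (par E v) * of_real (wpow E mu m (par E u))"
      using uv by (intro coherentD[OF f]) (auto simp: funpow_swap1)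
    then show ?thesis
      using uv by (simp add: Suc h wshift_def wpow_Suc)
  qed (use uv in simp)
  then show "h \<in> coherent"
    using f by (auto simp: coherent_def h wshift_in_ell2)
next
  fix f assume f: "f \<in> coherent"
  obtain ch where ch: "\<And>u. u \<in> V \<Longrightarrow> ch u \<in> V" "\<And>u. u \<in> V \<Longrightarrow> par E (ch u) = u"
    using child_selection by blast
  define g where "g u = (if u \<in> V then f (ch u) / of_real (mu (ch u)) else 0)" for u
  have mu_nz: "mu v \<noteq> 0" if "v \<in> V" for v
    using weight_pos[OF that] by simp
  have Sg: "S g = f"
  proof
    fix v
    show "S g v = f v"
    proof (cases "v \<in> V")
      case True
      then have "f v * of_real (wpow E mu 1 (ch (par E v))) = f (ch (par E v)) * of_real (wpow E mu 1 v)"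
        by (intro coherentD[OF f]) (auto simp: ch)
      then show ?thesis
        using True mu_nz[of "ch (par E v)"] ch(1)[of "par E v"]
        by (simp add: wshift_def g_def wpow_Suc field_simps)
    next
      case False
      then show ?thesis
        using f by (auto simp: wshift_def coherent_def ell2_def)
    qed
  qed
  have "g \<in> ell2 V"
    using wshift_in_ell2_iff[of g] Sg f coherent_subset by (auto simp: g_def)
  moreover have "g u * of_real (wpow E mu n v) = g v * of_real (wpow E mu n u)"
    if uv: "u \<in> V" "v \<in> V" "(par E ^^ n) u = (par E ^^ n) v" for n u v
  proof -
    have "f (ch u) * of_real (wpow E mu (Suc n) (ch v)) = f (ch v) * of_real (wpow E mu (Suc n) (ch u))"
      using uv ch by (intro coherentD[OF f]) (auto simp: funpow_swap1)
    then show ?thesis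
      using uv ch mu_nz[of "ch u"] mu_nz[of "ch v"] by (simp add: g_def wpow_Suc field_simps)
  qed
  ultimately have "g \<in> coherent"
    by (auto simp: coherent_def)
  then show "f \<in> S ` coherent"
    using Sg by blast
qed

lemma hyper_range_eq_coherent: "hyper_range V S = coherent"
proof
  have "(S ^^ n) ` coherent = coherent" for n
  proof (induction n)
    case (Suc n)
    have "(S ^^ Suc n) ` coherent = S ` (S ^^ n) ` coherent"
      by (simp add: image_comp)
    then show ?case
      by (simp only: Suc wshift_image_coherent)
  qed simp
  then show "coherent \<subseteq> hyper_range V S"
    using coherent_subset unfolding hyper_range_def by blast
  show "hyper_range V S \<subseteq> coherent"
  proof
    fix f assume "f \<in> hyper_range V S"
    then have f: "\<exists>g\<in>ell2 V. f = (S ^^ n) g" for n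
      by (auto simp: hyper_range_def)
    have "f u * of_real (wpow E mu n v) = f v * of_real (wpow E mu n u)"
      if "u \<in> V" "v \<in> V" "(par E ^^ n) u = (par E ^^ n) v" for n u v
      using f[of n] that by (auto simp: wshift_funpow)
    then show "f \<in> coherent"
      using f[of 0] by (auto simp: coherent_def)
  qed
qed

text \<open>Each coherence condition is orthogonality to a vector supported on two vertices. Hence the coherent
  functions form a closed subspace.\<close>

lemma coherent_eq_orth:
  "\<exists>X\<subseteq>ell2 V. coherent = orth V X"
proof (intro exI conjI)
  let ?t = "\<lambda>n u v. scaleC (of_real (wpow E mu n v)) (indicator {u}) - scaleC (of_real (wpow E mu n u)) (indicator {v})"
  let ?X = "{?t n u v | n u v. u \<in> V \<and> v \<in> V \<and> (par E ^^ n) u = (par E ^^ n) v}"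
  show "?X \<subseteq> ell2 V"
    by (auto intro!: ell2_diff ell2_scaleC ell2_indicator)
  have "ell2_inner V f (?t n u v) = f u * of_real (wpow E mu n v) - f v * of_real (wpow E mu n u)"
    if "f \<in> ell2 V" "u \<in> V" "v \<in> V" for f n u v
    using that by (simp add: ell2_inner_diff_right ell2_scaleC ell2_indicator ell2_inner_indicator)
  then show "coherent = orth V ?X"
    by (fastforce simp: coherent_def orth_def)
qed

lemma csubspace_coherent: "csubspace coherent"
  using coherent_eq_orth csubspace_orth by metis

lemma closedin_coherent: "closedin (ell2_topology V) coherent"
  using coherent_eq_orth closedin_orth by metis

section \<open>The coherent vector of a generation\<close>

text \<open>Up to a scalar there is only one coherent function on the generation of \<open>v\<close>, normalised here to be
  \<open>1\<close> at \<open>v\<close>. The definition uses the first common ancestor; by \<open>wpow_ratio_eq\<close> every common ancestor gives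
  the same value.\<close>

definition gen_vec :: "'v \<Rightarrow> 'v \<Rightarrow> complex" where
  "gen_vec v u = (if u \<in> V \<and> same_generation E u v
     then let n = (LEAST n. (par E ^^ n) u = (par E ^^ n) v) in of_real (wpow E mu n u / wpow E mu n v)
     else 0)"

lemma gen_vec_eq:
  assumes "u \<in> V" "v \<in> V" "(par E ^^ n) u = (par E ^^ n) v"
  shows "gen_vec v u = of_real (wpow E mu n u / wpow E mu n v)"
proof -
  have "(par E ^^ (LEAST n. (par E ^^ n) u = (par E ^^ n) v)) u = (par E ^^ (LEAST n. (par E ^^ n) u = (par E ^^ n) v)) v"
    using assms(3) by (rule LeastI)
  then have "wpow E mu (LEAST n. (par E ^^ n) u = (par E ^^ n) v) u / wpow E mu (LEAST n. (par E ^^ n) u = (par E ^^ n) v) v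
      = wpow E mu n u / wpow E mu n v"
    using assms by (intro wpow_ratio_eq)
  moreover have "same_generation E u v"
    using assms(3) by (auto simp: same_generation_def)
  ultimately show ?thesis
    using assms by (simp add: gen_vec_def Let_def flip: of_real_divide)
qed

lemma gen_vec_outside: "\<not> (u \<in> V \<and> same_generation E u v) \<Longrightarrow> gen_vec v u = 0"
  by (simp only: gen_vec_def if_False)

lemma gen_vec_self: "v \<in> V \<Longrightarrow> gen_vec v v = 1"
  using gen_vec_eq[of v v 0] by simp

lemma gen_vec_nonzero:
  assumes "u \<in> V" "v \<in> V" "same_generation E u v"
  shows "gen_vec v u \<noteq> 0"
proof -
  obtain n where "(par E ^^ n) u = (par E ^^ n) v"
    using assms by (auto simp: same_generation_def)
  then show ?thesis
    using assms gen_vec_eq[of u v n] wpow_pos[of u n] wpow_pos[of v n] by simp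
qed

lemma gen_vec_proportional:
  assumes "u \<in> V" "v \<in> V" "same_generation E u v"
  shows "gen_vec v = scaleC (gen_vec v u) (gen_vec u)"
proof
  fix x
  show "gen_vec v x = scaleC (gen_vec v u) (gen_vec u) x"
  proof (cases "x \<in> V \<and> same_generation E x u")
    case True
    obtain n where n: "(par E ^^ n) x = (par E ^^ n) u" "(par E ^^ n) u = (par E ^^ n) v"
      using same_generation_common[of x u v] assms True by blast
    then show ?thesis
      using assms True gen_vec_eq[of x v n] gen_vec_eq[of x u n] gen_vec_eq[of u v n] wpow_pos[of u n]
      by (simp add: scaleC_def)
  next
    case False
    then have "\<not> (x \<in> V \<and> same_generation E x v)"
      using assms same_generation_sym same_generation_trans by blast
    then show ?thesis
      using False by (simp add: gen_vec_outside scaleC_def)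
  qed
qed

lemma wshift_gen_vec:
  assumes "v \<in> V"
  shows "S (gen_vec (par E v)) = scaleC (of_real (mu v)) (gen_vec v)"
proof
  fix u
  show "S (gen_vec (par E v)) u = scaleC (of_real (mu v)) (gen_vec v) u"
  proof (cases "u \<in> V \<and> same_generation E u v")
    case True
    then obtain n where n: "(par E ^^ n) u = (par E ^^ n) v"
      by (auto simp: same_generation_def)
    then have "(par E ^^ Suc n) u = (par E ^^ Suc n) v"
      by simp
    moreover have "(par E ^^ n) (par E u) = (par E ^^ n) (par E v)"
      using n by (simp flip: funpow_swap1)
    ultimately show ?thesis
      using True assms gen_vec_eq[of u v "Suc n"] gen_vec_eq[of "par E u" "par E v" n] weight_pos[of v]
      by (simp add: wshift_def scaleC_def wpow_Suc)
  next
    case False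
    then show ?thesis
      by (auto simp: wshift_def scaleC_def gen_vec_outside)
  qed
qed

lemma gen_vec_in_ell2_par_iff:
  assumes "v \<in> V"
  shows "gen_vec (par E v) \<in> ell2 V \<longleftrightarrow> gen_vec v \<in> ell2 V"
proof -
  have "gen_vec (par E v) \<in> ell2 V \<longleftrightarrow> scaleC (of_real (mu v)) (gen_vec v) \<in> ell2 V"
    using wshift_in_ell2_iff[of "gen_vec (par E v)"] wshift_gen_vec[OF assms] by (simp add: gen_vec_outside)
  also have "\<dots> \<longleftrightarrow> gen_vec v \<in> ell2 V"
  proof
    assume "scaleC (of_real (mu v)) (gen_vec v) \<in> ell2 V"
    then have "scaleC (of_real (inverse (mu v))) (scaleC (of_real (mu v)) (gen_vec v)) \<in> ell2 V"
      by (rule ell2_scaleC)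
    then show "gen_vec v \<in> ell2 V"
      using weight_pos[OF assms] by simp
  qed (rule ell2_scaleC)
  finally show ?thesis .
qed

lemma gen_vec_in_ell2_iff:
  assumes "u \<in> V" "v \<in> V"
  shows "gen_vec u \<in> ell2 V \<longleftrightarrow> gen_vec v \<in> ell2 V"
  using invariant_along_edges[of "\<lambda>v. gen_vec v \<in> ell2 V"] gen_vec_in_ell2_par_iff assms by blast

lemma gen_vec_coherent:
  assumes v: "v \<in> V" and "gen_vec v \<in> ell2 V"
  shows "gen_vec v \<in> coherent"
proof -
  have "gen_vec v x * of_real (wpow E mu n y) = gen_vec v y * of_real (wpow E mu n x)"
    if xy: "x \<in> V" "y \<in> V" "(par E ^^ n) x = (par E ^^ n) y" for n x y
  proof (cases "same_generation E x v")
    case True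
    have "gen_vec v = scaleC (gen_vec v x) (gen_vec x)"
      using xy v True by (intro gen_vec_proportional)
    then have "gen_vec v y = gen_vec v x * gen_vec x y"
      by (metis scaleC_def)
    also have "gen_vec x y = of_real (wpow E mu n y / wpow E mu n x)"
      using xy by (intro gen_vec_eq) auto
    finally show ?thesis
      using wpow_pos[OF xy(1), of n] by simp
  next
    case False
    have "same_generation E x y"
      using xy by (auto simp: same_generation_def)
    then have "\<not> same_generation E y v"
      using False same_generation_trans by blast
    then show ?thesis
      using False by (simp add: gen_vec_outside)
  qed
  then show ?thesis
    using assms by (auto simp: coherent_def)
qed

lemma coherent_eq_on_generation:
  assumes f: "f \<in> coherent" and "u \<in> V" "v \<in> V" "same_generation E u v"
  shows "f u = f v * gen_vec v u"
proof -
  obtain n where n: "(par E ^^ n) u = (par E ^^ n) v"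
    using assms by (auto simp: same_generation_def)
  then have "f u * of_real (wpow E mu n v) = f v * of_real (wpow E mu n u)"
    using assms by (intro coherentD[OF f])
  then have "f u = f v * of_real (wpow E mu n u) / of_real (wpow E mu n v)"
    using wpow_pos[OF assms(3), of n] by (subst nonzero_eq_divide_eq) auto
  then show ?thesis
    using gen_vec_eq[OF assms(2,3) n] by simp
qed

text \<open>Each coherent function dominates its restriction to a generation, which is a multiple of the vector
  of that generation.\<close>

lemma coherent_zero_if_gen_vec_notin:
  assumes "\<And>v. v \<in> V \<Longrightarrow> gen_vec v \<notin> ell2 V"
  shows "coherent = {0}"
proof -
  have "f v = 0" if f: "f \<in> coherent" for f v
  proof (rule ccontr)
    assume nz: "f v \<noteq> 0"
    have fm: "f \<in> ell2 V"
      using f coherent_subset by blast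
    then have v: "v \<in> V"
      using nz by (auto simp: ell2_def)
    have sf: "(\<lambda>u. (cmod (f u))\<^sup>2) summable_on V"
      using fm by (simp add: ell2_def)
    have "(\<lambda>u. (cmod (f v * gen_vec v u))\<^sup>2) summable_on V"
    proof (rule summable_on_comparison_test[OF sf])
      fix u assume "u \<in> V"
      then show "(cmod (f v * gen_vec v u))\<^sup>2 \<le> (cmod (f u))\<^sup>2"
        using coherent_eq_on_generation[OF f _ v, of u]
        by (cases "same_generation E u v") (auto simp: gen_vec_outside)
    qed auto
    then have "scaleC (f v) (gen_vec v) \<in> ell2 V"
      by (auto simp: ell2_def scaleC_def gen_vec_outside)
    then have "scaleC (inverse (f v)) (scaleC (f v) (gen_vec v)) \<in> ell2 V"
      by (rule ell2_scaleC)
    then show False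
      using assms[OF v] nz by simp
  qed
  moreover have "0 \<in> coherent"
    using csubspace_coherent by (rule cfun.subspace_0)
  ultimately show ?thesis
    by (auto simp: fun_eq_iff)
qed

section \<open>The sums alpha\<close>

text \<open>The layers partition the generation of \<open>v\<close> according to the first common ancestor with \<open>v\<close>, so the
  double sum that defines \<open>\<alpha>(v)\<close> is the squared norm of the coherent vector.\<close>

lemma alpha_eq_infsum:
  assumes v: "v \<in> V"
  shows "alpha E mu v = (\<Sum>\<^sub>\<infinity>u\<in>V. ennreal ((cmod (gen_vec v u))\<^sup>2))"
proof -
  define F where "F = (\<lambda>u. ennreal ((cmod (gen_vec v u))\<^sup>2))"
  have layer: "(\<Sum>\<^sub>\<infinity>u\<in>gen_layer E v n. ennreal ((wpow E mu n u / wpow E mu n v)\<^sup>2)) = (\<Sum>\<^sub>\<infinity>u\<in>gen_layer E v n. F u)" for n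
  proof (rule infsum_cong)
    fix u assume "u \<in> gen_layer E v n"
    then have "gen_vec v u = of_real (wpow E mu n u / wpow E mu n v)"
      using v by (intro gen_vec_eq) (auto simp: gen_layer_eq)
    then show "ennreal ((wpow E mu n u / wpow E mu n v)\<^sup>2) = F u"
      by (simp only: F_def norm_of_real power2_abs)
  qed
  have "alpha E mu v = infsum F (\<Union>n. gen_layer E v n)"
    unfolding alpha_def layer using v
    by (intro suminf_infsum_ennreal) (auto simp: disjoint_family_on_def gen_layer_eq)
  also have "\<dots> = infsum F V"
  proof (rule infsum_cong_neutral)
    fix u assume u: "u \<in> V - (\<Union>n. gen_layer E v n)"
    have "\<not> same_generation E u v"
    proof
      assume "same_generation E u v"
      then have "\<exists>n. (par E ^^ n) u = (par E ^^ n) v"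
        by (simp add: same_generation_def)
      then have "(par E ^^ (LEAST n. (par E ^^ n) u = (par E ^^ n) v)) u = (par E ^^ (LEAST n. (par E ^^ n) u = (par E ^^ n) v)) v"
        by (rule LeastI_ex)
      then have "u \<in> gen_layer E v (LEAST n. (par E ^^ n) u = (par E ^^ n) v)"
        using u v by (simp add: gen_layer_eq)
      then show False
        using u by blast
    qed
    then show "F u = 0"
      by (simp add: F_def gen_vec_outside)
  qed (use v in \<open>auto simp: gen_layer_eq\<close>)
  finally show ?thesis
    by (simp add: F_def)
qed

lemma alpha_finite_iff:
  assumes "v \<in> V"
  shows "alpha E mu v < \<infinity> \<longleftrightarrow> gen_vec v \<in> ell2 V"
  unfolding alpha_eq_infsum[OF assms]
  using ell2_if_infsum_ennreal_finite[of V "gen_vec v"] infsum_ennreal_square[of "gen_vec v"]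
  by (auto simp: gen_vec_outside)

lemma alpha_eq_norm:
  assumes "v \<in> V" "gen_vec v \<in> ell2 V"
  shows "alpha E mu v = ennreal ((ell2_norm V (gen_vec v))\<^sup>2)"
  using assms by (simp only: alpha_eq_infsum infsum_ennreal_square)

lemma alpha_finite_cong:
  assumes "u \<in> V" "v \<in> V"
  shows "alpha E mu u < \<infinity> \<longleftrightarrow> alpha E mu v < \<infinity>"
  using assms by (simp only: alpha_finite_iff gen_vec_in_ell2_iff[OF assms])


lemma ell2_norm_gen_vec_pos:
  assumes "v \<in> V" "gen_vec v \<in> ell2 V"
  shows "ell2_norm V (gen_vec v) > 0"
  using ell2_norm_eq_0[OF assms(2)] gen_vec_self[OF assms(1)] ell2_norm_nonneg[of V "gen_vec v"]
  by (metis less_eq_real_def zero_fun_apply zero_neq_one)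

text \<open>Both sides of the weight equation are norms in disguise: \<open>\<alpha>\<close> is a squared norm, and \<open>S\<close> maps the vector
  of the parent to \<open>\<mu>\<^sub>v\<close> times the vector of \<open>v\<close>.\<close>

lemma alpha_weight_eq_iff:
  assumes v: "v \<in> V" and fin: "gen_vec v \<in> ell2 V"
  shows "alpha_weight_eq E mu v \<longleftrightarrow> ell2_norm V (S (gen_vec (par E v))) = ell2_norm V (gen_vec (par E v))"
proof -
  have "alpha_weight_eq E mu v \<longleftrightarrow> mu v = ell2_norm V (gen_vec (par E v)) / ell2_norm V (gen_vec v)"
    using assms gen_vec_in_ell2_par_iff[OF v]
    by (simp add: alpha_weight_eq_def alpha_eq_norm enn2real_ennreal real_sqrt_divide)
  also have "\<dots> \<longleftrightarrow> mu v * ell2_norm V (gen_vec v) = ell2_norm V (gen_vec (par E v))"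
    using ell2_norm_gen_vec_pos[OF assms] by (simp add: field_simps)
  also have "mu v * ell2_norm V (gen_vec v) = ell2_norm V (S (gen_vec (par E v)))"
    using weight_pos[OF v] by (simp add: wshift_gen_vec[OF v] ell2_norm_scaleC)
  finally show ?thesis .
qed

text \<open>By proportionality of the vectors of one generation, \<open>S\<close> preserves the norm of all of them or of
  none.\<close>

lemma alpha_weight_eq_cong:
  assumes u: "u \<in> V" and v: "v \<in> V" and gen: "same_generation E u v" and fin: "gen_vec v \<in> ell2 V"
  shows "alpha_weight_eq E mu u \<longleftrightarrow> alpha_weight_eq E mu v"
proof -
  define a where "a = gen_vec (par E v) (par E u)"
  have gen': "same_generation E (par E u) (par E v)"
    using gen by simp
  have "a \<noteq> 0"
    unfolding a_def using u v gen' by (intro gen_vec_nonzero) auto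
  have "gen_vec (par E v) = scaleC a (gen_vec (par E u))"
    unfolding a_def using u v gen' by (intro gen_vec_proportional) auto
  then have "ell2_norm V (S (gen_vec (par E v))) = cmod a * ell2_norm V (S (gen_vec (par E u)))"
    and "ell2_norm V (gen_vec (par E v)) = cmod a * ell2_norm V (gen_vec (par E u))"
    by (simp_all add: wshift_scaleC ell2_norm_scaleC)
  then show ?thesis
    using \<open>a \<noteq> 0\<close> u v fin gen_vec_in_ell2_iff[OF u v] by (simp add: alpha_weight_eq_iff)
qed

text \<open>A balanced shift scales the squared norms of all functions on a generation by one constant, the
  common value of \<open>\<parallel>S e\<^sub>u\<parallel>\<^sup>2\<close>; the vector of the generation detects it.\<close>

lemma child_mass_eq_1:
  assumes "balanced V E mu" and u: "u \<in> V" and fin: "gen_vec u \<in> ell2 V"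
    and isometric: "ell2_norm V (S (gen_vec u)) = ell2_norm V (gen_vec u)"
  shows "child_mass u = 1"
proof -
  have "(ell2_norm V (gen_vec u))\<^sup>2 = (\<Sum>\<^sub>\<infinity>x\<in>V. child_mass x * (cmod (gen_vec u x))\<^sup>2)"
    using ell2_norm_wshift[OF fin] isometric by simp
  also have "\<dots> = (\<Sum>\<^sub>\<infinity>x\<in>V. child_mass u * (cmod (gen_vec u x))\<^sup>2)"
  proof (rule infsum_cong)
    fix x assume x: "x \<in> V"
    show "child_mass x * (cmod (gen_vec u x))\<^sup>2 = child_mass u * (cmod (gen_vec u x))\<^sup>2"
    proof (cases "same_generation E x u")
      case True
      then have "child_mass x = child_mass u"
        using assms(1) x u True unfolding balanced_iff by blast
      then show ?thesis by simp
    next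
      case False
      then show ?thesis by (simp add: gen_vec_outside)
    qed
  qed
  also have "\<dots> = child_mass u * (ell2_norm V (gen_vec u))\<^sup>2"
    by (simp add: infsum_cmult_right' ell2_norm_square)
  finally have "1 * (ell2_norm V (gen_vec u))\<^sup>2 = child_mass u * (ell2_norm V (gen_vec u))\<^sup>2"
    by simp
  then show ?thesis
    using ell2_norm_gen_vec_pos[OF u fin] by (simp only: mult_cancel_right) auto
qed

end

section \<open>The Cauchy dual\<close>

text \<open>The dual weights are a separate parameter because they matter, and are prescribed, on \<open>V\<close> only.\<close>

locale cauchy_dual_pair = weighted_tree V E mu c C
  for V :: "'v set" and E :: "('v \<times> 'v) set" and mu :: "'v \<Rightarrow> real" and c C :: real +
  fixes nu :: "'v \<Rightarrow> real"
  assumes dual_weight: "v \<in> V \<Longrightarrow> nu v = mu v / child_mass (par E v)"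
begin

lemma dual_square:
  assumes "v \<in> Chi E {u}"
  shows "(nu v)\<^sup>2 = inverse ((child_mass u)\<^sup>2) * (mu v)\<^sup>2"
  using assms by (simp add: Chi_eq dual_weight power_divide divide_inverse power_mult_distrib power_inverse mult.commute)

lemma dual_mass:
  assumes "u \<in> V"
  shows "(\<Sum>\<^sub>\<infinity>v\<in>Chi E {u}. (nu v)\<^sup>2) = 1 / child_mass u"
proof -
  have "(\<Sum>\<^sub>\<infinity>v\<in>Chi E {u}. (nu v)\<^sup>2) = (\<Sum>\<^sub>\<infinity>v\<in>Chi E {u}. inverse ((child_mass u)\<^sup>2) * (mu v)\<^sup>2)"
    by (intro infsum_cong dual_square)
  also have "\<dots> = inverse ((child_mass u)\<^sup>2) * child_mass u"
    by (simp add: infsum_cmult_right' child_mass_def)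
  also have "\<dots> = 1 / child_mass u"
    using child_mass_pos[OF assms] by (simp add: power2_eq_square divide_inverse)
  finally show ?thesis .
qed

sublocale dual: weighted_tree V E nu "1 / C" "1 / c"
proof
  show "nu v > 0" if "v \<in> V" for v
    using that weight_pos child_mass_pos[of "par E v"] by (simp add: dual_weight)
  show "(\<lambda>v. (nu v)\<^sup>2) summable_on Chi E {u}" if "u \<in> V" for u
  proof -
    have "(\<lambda>v. inverse ((child_mass u)\<^sup>2) * (mu v)\<^sup>2) summable_on Chi E {u}"
      using that by (intro summable_on_cmult_right weights_summable)
    then show ?thesis
      by (elim summable_on_cong[THEN iffD1, rotated]) (simp add: dual_square)
  qed
  show "1 / C > 0" "1 / c > 0"
    using lower_pos upper_pos by auto
  show "1 / C \<le> (\<Sum>\<^sub>\<infinity>v\<in>Chi E {u}. (nu v)\<^sup>2)" "(\<Sum>\<^sub>\<infinity>v\<in>Chi E {u}. (nu v)\<^sup>2) \<le> 1 / c" if "u \<in> V" for u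
    using lower[OF that] upper[OF that] lower_pos child_mass_pos[OF that]
    by (simp_all add: dual_mass that frac_le flip: child_mass_def)
qed

text \<open>On the children of each vertex the products of weights and dual weights sum to \<open>1\<close>.\<close>

lemma dual_wshift_inner:
  assumes f: "f \<in> ell2 V" and g: "g \<in> ell2 V"
  shows "ell2_inner V (dual.S f) (S g) = ell2_inner V f g"
proof -
  define r where "r v = (mu v)\<^sup>2 / child_mass (par E v)" for v
  define \<phi> where "\<phi> u = f u * cnj (g u)" for u
  have eq: "dual.S f v * cnj (S g v) = of_real (r v) * \<phi> (par E v)" if "v \<in> V" for v
    using that by (simp add: wshift_def dual_weight r_def \<phi>_def power2_eq_square)
  have r0: "r v \<ge> 0" if "v \<in> V" for v
    using child_mass_pos[of "par E v"] that by (simp add: r_def)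
  have r_eq: "r v = inverse (child_mass u) * (mu v)\<^sup>2" if "v \<in> Chi E {u}" for u v
    using that by (simp add: r_def Chi_eq divide_inverse mult.commute)
  have r_sum: "r summable_on Chi E {u}" if "u \<in> V" for u
  proof -
    have "(\<lambda>v. inverse (child_mass u) * (mu v)\<^sup>2) summable_on Chi E {u}"
      using that by (intro summable_on_cmult_right weights_summable)
    then show ?thesis
      by (elim summable_on_cong[THEN iffD1, rotated]) (simp add: r_eq)
  qed
  have r1: "infsum r (Chi E {u}) = 1" if "u \<in> V" for u
  proof -
    have "infsum r (Chi E {u}) = (\<Sum>\<^sub>\<infinity>v\<in>Chi E {u}. inverse (child_mass u) * (mu v)\<^sup>2)"
      by (intro infsum_cong r_eq)
    also have "\<dots> = inverse (child_mass u) * child_mass u"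
      by (simp add: infsum_cmult_right' child_mass_def)
    finally show ?thesis
      using child_mass_pos[OF that] by simp
  qed
  have "(\<lambda>v. norm (dual.S f v * cnj (S g v))) summable_on V"
    using f g by (intro ell2_inner_abs_summable wshift_in_ell2 dual.wshift_in_ell2)
  then have "(\<lambda>v. norm (of_real (r v) * \<phi> (par E v))) summable_on V"
    by (elim summable_on_cong[THEN iffD1, rotated]) (simp only: eq)
  then have "(\<Sum>\<^sub>\<infinity>v\<in>V. of_real (r v) * \<phi> (par E v)) = (\<Sum>\<^sub>\<infinity>u\<in>V. of_real (infsum r (Chi E {u})) * \<phi> u)"
    using r0 r_sum by (intro infsum_children)
  also have "\<dots> = (\<Sum>\<^sub>\<infinity>u\<in>V. \<phi> u)"
    by (intro infsum_cong) (simp add: r1)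
  also have "\<dots> = ell2_inner V f g"
    by (simp add: ell2_inner_def \<phi>_def)
  also have "(\<Sum>\<^sub>\<infinity>v\<in>V. of_real (r v) * \<phi> (par E v)) = ell2_inner V (dual.S f) (S g)"
    unfolding ell2_inner_def by (intro infsum_cong) (simp only: eq)
  finally show ?thesis .
qed

lemma dual_range_subset: "dual.S ` ell2 V \<subseteq> S ` ell2 V"
proof
  fix h assume "h \<in> dual.S ` ell2 V"
  then obtain g where g: "g \<in> ell2 V" "h = dual.S g"
    by blast
  define g' where "g' u = (if u \<in> V then g u / of_real (child_mass u) else 0)" for u
  have "S g' = h"
    by (auto simp: g g'_def wshift_def dual_weight)
  moreover have "g' \<in> ell2 V"
    using wshift_in_ell2_iff[of g'] \<open>S g' = h\<close> dual.wshift_in_ell2[OF g(1)] g by (simp add: g'_def)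
  ultimately show "h \<in> S ` ell2 V"
    by blast
qed

text \<open>The two-point vectors \<open>\<mu>\<^sub>y e\<^sub>x - \<mu>\<^sub>x e\<^sub>y\<close> with siblings \<open>x\<close> and \<open>y\<close> are orthogonal to the range of \<open>S\<close>.
  A function \<open>f\<close> orthogonal to all of them has values proportional to the weights on each sibling set, and
  dividing by the dual weights turns it into a function of the parent, a preimage under the dual shift.\<close>

lemma orth_orth_range:
  assumes f: "f \<in> orth V (orth V (S ` ell2 V))"
  shows "f \<in> dual.S ` ell2 V"
proof -
  have fm: "f \<in> ell2 V"
    using f by (simp add: orth_def)
  have sib: "f x * of_real (mu y) = f y * of_real (mu x)" if xy: "x \<in> V" "y \<in> V" "par E x = par E y" for x y
  proof -
    define t where "t = scaleC (of_real (mu y)) (indicator {x}) - scaleC (of_real (mu x)) (indicator {y})"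
    have tm: "t \<in> ell2 V"
      using xy by (auto simp: t_def intro!: ell2_diff ell2_scaleC ell2_indicator)
    have inner: "ell2_inner V h t = h x * of_real (mu y) - h y * of_real (mu x)" if "h \<in> ell2 V" for h
      using xy that by (simp add: t_def ell2_inner_diff_right ell2_scaleC ell2_indicator ell2_inner_indicator)
    have "ell2_inner V (S g) t = 0" if "g \<in> ell2 V" for g
      using xy by (simp add: inner wshift_in_ell2[OF that]) (simp add: wshift_def)
    then have "t \<in> orth V (S ` ell2 V)"
      using tm by (auto simp: orth_def ell2_inner_commute[of V t])
    then show ?thesis
      using f inner[OF fm] by (simp add: orth_def)
  qed
  obtain ch where ch: "\<And>u. u \<in> V \<Longrightarrow> ch u \<in> V" "\<And>u. u \<in> V \<Longrightarrow> par E (ch u) = u"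
    using child_selection by blast
  define g where "g u = (if u \<in> V then f (ch u) / of_real (nu (ch u)) else 0)" for u
  have "dual.S g v = f v" for v
  proof (cases "v \<in> V")
    case True
    let ?w = "ch (par E v)"
    have w: "?w \<in> V" "par E ?w = par E v"
      using True ch by auto
    have "f v * of_real (mu ?w) = f ?w * of_real (mu v)"
      using sib[OF True w(1)] w(2) by simp
    then show ?thesis
      using True w weight_pos[OF w(1)] child_mass_pos[of "par E v"]
      by (simp add: wshift_def g_def dual_weight field_simps)
  next
    case False
    then show ?thesis
      using fm by (simp add: wshift_def ell2_def)
  qed
  then have Sg: "dual.S g = f"
    by blast
  then have "g \<in> ell2 V"
    using dual.wshift_in_ell2_iff[of g] fm by (simp add: g_def)
  then show ?thesis
    using Sg by blast
qed

text \<open>Shimorin's duality. If \<open>f\<close> is orthogonal to all \<open>S\<^sup>n k\<close> with \<open>k\<close> orthogonal to the range of \<open>S\<close>, then the case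
  \<open>n = 0\<close> gives \<open>f = S' g\<close>, and \<open>\<langle>S' g, S\<^sup>n\<^sup>+\<^sup>1 k\<rangle> = \<langle>g, S\<^sup>n k\<rangle>\<close> shows that \<open>g\<close> has the same orthogonality property.
  So \<open>S'\<close> can be peeled off any number of times; reading the identity backwards gives the converse.\<close>

lemma orth_generated_eq_dual_coherent:
  "orth V {(S ^^ n) k | n k. k \<in> orth V (S ` ell2 V)} = dual.coherent"
proof
  let ?X = "{(S ^^ n) k | n k. k \<in> orth V (S ` ell2 V)}"
  have km: "k \<in> ell2 V" if "k \<in> orth V (S ` ell2 V)" for k
    using that by (simp add: orth_def)
  have step: "orth V ?X \<subseteq> dual.S ` orth V ?X"
  proof
    fix f assume f: "f \<in> orth V ?X"
    have fX: "ell2_inner V f ((S ^^ n) k) = 0" if "k \<in> orth V (S ` ell2 V)" for n k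
      using f that by (auto simp: orth_def)
    have "f \<in> orth V (orth V (S ` ell2 V))"
      using f fX[of _ 0] by (auto simp: orth_def)
    then obtain g where g: "g \<in> ell2 V" "f = dual.S g"
      using orth_orth_range by blast
    have "ell2_inner V g ((S ^^ n) k) = 0" if "k \<in> orth V (S ` ell2 V)" for n k
      using fX[OF that, of "Suc n"] dual_wshift_inner[OF g(1) wshift_funpow_in_ell2[OF km[OF that]], of n]
      by (simp add: g)
    then have "g \<in> orth V ?X"
      using g by (auto simp: orth_def)
    then show "f \<in> dual.S ` orth V ?X"
      using g by blast
  qed
  have "orth V ?X \<subseteq> (dual.S ^^ n) ` orth V ?X" for n
  proof (induction n)
    case (Suc n)
    have "orth V ?X \<subseteq> dual.S ` (dual.S ^^ n) ` orth V ?X"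
      using step Suc by blast
    also have "\<dots> = (dual.S ^^ Suc n) ` orth V ?X"
      by (simp add: image_comp)
    finally show ?case .
  qed simp
  moreover have "orth V ?X \<subseteq> ell2 V"
    by (auto simp: orth_def)
  ultimately have "orth V ?X \<subseteq> hyper_range V dual.S"
    unfolding hyper_range_def by (meson INT_greatest image_mono order_trans)
  then show "orth V ?X \<subseteq> dual.coherent"
    by (simp only: dual.hyper_range_eq_coherent)
  have "ell2_inner V f ((S ^^ n) k) = 0"
    if k: "k \<in> orth V (S ` ell2 V)" and "f \<in> dual.coherent" for f n k
    using \<open>f \<in> dual.coherent\<close>
  proof (induction n arbitrary: f)
    case 0
    then have "f \<in> dual.S ` dual.coherent"
      by (simp only: dual.wshift_image_coherent)
    then have "f \<in> S ` ell2 V"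
      using dual_range_subset dual.coherent_subset by blast
    then show ?case
      using k by (auto simp: orth_def ell2_inner_commute[of V _ k])
  next
    case (Suc n)
    then have "f \<in> dual.S ` dual.coherent"
      by (simp only: dual.wshift_image_coherent)
    then obtain g where g: "g \<in> dual.coherent" "f = dual.S g"
      by blast
    have "g \<in> ell2 V"
      using g dual.coherent_subset by blast
    then show ?case
      using Suc.IH[OF g(1)] dual_wshift_inner[OF _ wshift_funpow_in_ell2[OF km[OF k]], of g n] by (simp add: g)
  qed
  then show "dual.coherent \<subseteq> orth V ?X"
    using dual.coherent_subset by (auto simp: orth_def)
qed

section \<open>Wold-type decompositions\<close>

text \<open>The direct sum condition alone is equivalent to the equality of the two spaces of coherent
  functions. The equality implies that the space reduces \<open>S\<close>: every coherent \<open>h\<close> is then \<open>S' g\<close> with \<open>g\<close> coherent,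
  so \<open>\<langle>S f, h\<rangle> = \<langle>f, g\<rangle>\<close> vanishes for \<open>f\<close> orthogonal to the coherent functions.\<close>

lemma wold_type_decomposition_iff:
  "wold_type_decomposition V S \<longleftrightarrow>
     (\<forall>f\<in>coherent. \<forall>g\<in>coherent. ell2_inner V (S f) (S g) = ell2_inner V f g) \<and> coherent = dual.coherent"
proof -
  let ?X = "{(S ^^ n) k | n k. k \<in> orth V (S ` ell2 V)}"
  have "?X \<subseteq> ell2 V"
    by (auto simp: orth_def intro: wshift_funpow_in_ell2)
  then have sum: "orth_direct_sum V (ell2 V) coherent (generated V S (ker V (ell2_adjoint V S)))
      \<longleftrightarrow> coherent = dual.coherent"
    unfolding generated_def ker_adjoint_eq_orth_range[OF bounded_wshift]
    using orth_direct_sum_closure_span_iff[OF _ coherent_subset] orth_generated_eq_dual_coherent by simp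
  have reduces: "reduces V coherent S" if dual: "coherent = dual.coherent"
    unfolding reduces_def
  proof (intro conjI csubspace_coherent closedin_coherent)
    show "S ` coherent \<subseteq> coherent"
      by (simp add: wshift_image_coherent)
    show "S ` orth V coherent \<subseteq> orth V coherent"
    proof (clarsimp simp: orth_def wshift_in_ell2)
      fix f h assume f: "f \<in> ell2 V" "\<forall>g\<in>coherent. ell2_inner V f g = 0" and h: "h \<in> coherent"
      obtain g where g: "g \<in> coherent" "h = dual.S g"
        using h dual.wshift_image_coherent unfolding dual by blast
      have gm: "g \<in> ell2 V"
        using g coherent_subset by blast
      have "ell2_inner V (S f) h = cnj (ell2_inner V g f)"
        using dual_wshift_inner[OF gm f(1)] ell2_inner_commute[of V "S f" h] by (simp add: g)
      also have "\<dots> = ell2_inner V f g"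
        by (rule ell2_inner_commute[symmetric])
      finally show "ell2_inner V (S f) h = 0"
        using f g by simp
    qed
  qed
  show ?thesis
    unfolding wold_type_decomposition_def hyper_range_eq_coherent sum unitary_on_def
    using reduces wshift_image_coherent by blast
qed

text \<open>\<open>S h\<^sub>v\<close> is coherent and hence equal to \<open>S' g\<close> with \<open>g\<close> coherent. Cancelling the weights gives
  \<open>g(x) = \<parallel>S e\<^sub>x\<parallel>\<^sup>2 h\<^sub>v(x)\<close>; but \<open>g\<close> is proportional to \<open>h\<^sub>v\<close> on the generation of \<open>v\<close>, so the factor is constant there.\<close>

lemma balanced_if_coherent_eq:
  assumes eq: "coherent = dual.coherent" and fin: "\<And>v. v \<in> V \<Longrightarrow> gen_vec v \<in> ell2 V"
  shows "balanced V E mu"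
  unfolding balanced_iff
proof (intro ballI impI)
  fix u v assume uv: "u \<in> V" "v \<in> V" "same_generation E u v"
  have "S (gen_vec v) \<in> S ` coherent"
    using gen_vec_coherent fin uv by blast
  also have "S ` coherent = dual.S ` coherent"
    using wshift_image_coherent dual.wshift_image_coherent eq by simp
  finally obtain g where g: "g \<in> coherent" "S (gen_vec v) = dual.S g"
    by blast
  have *: "g x = of_real (child_mass x) * gen_vec v x" if "x \<in> V" for x
  proof -
    obtain y where y: "y \<in> V" "par E y = x"
      using child_exists[OF \<open>x \<in> V\<close>] by blast
    have "S (gen_vec v) y = dual.S g y"
      using g by simp
    then show ?thesis
      using y weight_pos[OF y(1)] child_mass_pos[OF that] by (simp add: wshift_def dual_weight field_simps)
  qed
  have "of_real (child_mass u) * gen_vec v u = g u"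
    using * uv by simp
  also have "\<dots> = g v * gen_vec v u"
    using uv by (intro coherent_eq_on_generation g)
  also have "\<dots> = of_real (child_mass v) * gen_vec v u"
    using *[of v] uv gen_vec_self[of v] by simp
  finally show "child_mass u = child_mass v"
    using gen_vec_nonzero[OF uv] by simp
qed

lemma wold_iff_if_alpha_infinite:
  assumes "\<And>v. v \<in> V \<Longrightarrow> alpha E mu v = \<infinity>" and "V \<noteq> {}"
  shows "wold_type_decomposition V S \<longleftrightarrow> (\<forall>v\<in>V. alpha E nu v = \<infinity>)"
proof -
  have zero: "coherent = {0}"
  proof (rule coherent_zero_if_gen_vec_notin)
    fix v assume "v \<in> V"
    then show "gen_vec v \<notin> ell2 V"
      using assms(1)[of v] alpha_finite_iff[of v] by auto
  qed
  have "dual.coherent = {0} \<longleftrightarrow> (\<forall>v\<in>V. dual.gen_vec v \<notin> ell2 V)"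
  proof
    assume z: "dual.coherent = {0}"
    show "\<forall>v\<in>V. dual.gen_vec v \<notin> ell2 V"
    proof (intro ballI notI)
      fix v assume "v \<in> V" "dual.gen_vec v \<in> ell2 V"
      then show False
        using dual.gen_vec_coherent[of v] dual.gen_vec_self[of v] z by simp
    qed
  qed (use dual.coherent_zero_if_gen_vec_notin in blast)
  also have "\<dots> \<longleftrightarrow> (\<forall>v\<in>V. alpha E nu v = \<infinity>)"
    using dual.alpha_finite_iff by (auto simp: less_top[symmetric])
  finally have "coherent = dual.coherent \<longleftrightarrow> (\<forall>v\<in>V. alpha E nu v = \<infinity>)"
    using zero by auto
  moreover have "S 0 = 0"
    by (auto simp: wshift_def)
  ultimately show ?thesis
    unfolding wold_type_decomposition_iff zero by simp
qed

text \<open>Under the two conditions on the right all \<open>\<parallel>S e\<^sub>u\<parallel>\<close> equal \<open>1\<close>. Then \<open>S\<close> is its own Cauchy dual, hence an isometry,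
  and both parts of the criterion are immediate.\<close>

lemma wold_iff_if_alpha_finite:
  assumes fin: "\<And>v. v \<in> V \<Longrightarrow> alpha E mu v < \<infinity>"
  shows "wold_type_decomposition V S \<longleftrightarrow> (\<forall>v\<in>V. alpha_weight_eq E mu v) \<and> balanced V E mu"
proof
  have vec: "gen_vec v \<in> ell2 V" if "v \<in> V" for v
    using fin[OF that] alpha_finite_iff[OF that] by simp
  {
    assume wold: "wold_type_decomposition V S"
    have "alpha_weight_eq E mu v" if "v \<in> V" for v
    proof -
      let ?h = "gen_vec (par E v)"
      have h: "?h \<in> coherent" "?h \<in> ell2 V"
        using that vec gen_vec_coherent by auto
      have "ell2_inner V (S ?h) (S ?h) = ell2_inner V ?h ?h"
        using wold h unfolding wold_type_decomposition_iff by blast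
      then have "(ell2_norm V (S ?h))\<^sup>2 = (ell2_norm V ?h)\<^sup>2"
        using h by (simp add: ell2_inner_self wshift_in_ell2 del: of_real_power)
      then have "ell2_norm V (S ?h) = ell2_norm V ?h"
        by simp
      then show ?thesis
        using that vec by (simp add: alpha_weight_eq_iff)
    qed
    then show "(\<forall>v\<in>V. alpha_weight_eq E mu v) \<and> balanced V E mu"
      using wold balanced_if_coherent_eq vec unfolding wold_type_decomposition_iff by blast
  next
    assume ii: "(\<forall>v\<in>V. alpha_weight_eq E mu v) \<and> balanced V E mu"
    have mass: "child_mass u = 1" if u: "u \<in> V" for u
    proof -
      obtain v where v: "v \<in> V" "par E v = u"
        using child_exists[OF u] by blast
      then have "ell2_norm V (S (gen_vec u)) = ell2_norm V (gen_vec u)"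
        using ii vec alpha_weight_eq_iff[of v] by simp
      then show ?thesis
        using ii u vec by (intro child_mass_eq_1) auto
    qed
    have same: "dual.S = S"
      by (auto simp: wshift_def dual_weight mass fun_eq_iff)
    then have "coherent = dual.coherent"
      using hyper_range_eq_coherent dual.hyper_range_eq_coherent by simp
    moreover have "ell2_inner V (S f) (S g) = ell2_inner V f g" if "f \<in> coherent" "g \<in> coherent" for f g
      using dual_wshift_inner[of f g] that coherent_subset by (auto simp: same)
    ultimately show "wold_type_decomposition V S"
      unfolding wold_type_decomposition_iff by blast
  }
qed

end

section \<open>The characterisation for bounded left-invertible shifts\<close>

text \<open>Both bounds on \<open>\<parallel>S e\<^sub>u\<parallel>\<^sup>2\<close> come from applying the operator bounds to basis vectors. Adding \<open>1\<close> to the squared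
  operator bounds makes the constants positive without a case distinction.\<close>

lemma weighted_tree_if_bounded_left_invertible:
  assumes tree: "rootless_leafless_tree V E" and pos: "\<forall>v\<in>V. lam v > 0"
    and bdd: "bounded_operator V (wshift V E lam)" and inv: "left_invertible V (wshift V E lam)"
  shows "\<exists>c C. weighted_tree V E lam c C"
proof -
  interpret rootless_leafless_tree V E
    by (rule tree)
  let ?S = "wshift V E lam"
  obtain B where B: "\<And>f. f \<in> ell2 V \<Longrightarrow> ell2_norm V (?S f) \<le> B * ell2_norm V f"
    and Sm: "\<And>f. f \<in> ell2 V \<Longrightarrow> ?S f \<in> ell2 V"
    using bdd unfolding bounded_operator_def by blast
  obtain L D where D: "\<And>f. f \<in> ell2 V \<Longrightarrow> ell2_norm V (L f) \<le> D * ell2_norm V f"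
    and L: "\<And>f. f \<in> ell2 V \<Longrightarrow> L (?S f) = f"
    using inv unfolding left_invertible_def bounded_operator_def by blast
  have "weighted_tree V E lam (1 / (D\<^sup>2 + 1)) (B\<^sup>2 + 1)"
  proof
    show "lam v > 0" if "v \<in> V" for v
      using pos that by simp
    show "1 / (D\<^sup>2 + 1) > 0" "B\<^sup>2 + 1 > 0"
      by (simp_all add: add_nonneg_pos)
    fix u assume u: "u \<in> V"
    let ?e = "indicator {u} :: _ \<Rightarrow> complex"
    have e: "?e \<in> ell2 V"
      using u by (rule ell2_indicator)
    show "(\<lambda>v. (lam v)\<^sup>2) summable_on Chi E {u}"
      using Sm[OF e] wshift_indicator_in_ell2_iff[OF u] by blast
    have "ell2_norm V (?S ?e) \<le> B"
      using B[OF e] u by (simp add: ell2_norm_indicator)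
    then have "(ell2_norm V (?S ?e))\<^sup>2 \<le> B\<^sup>2"
      by (rule power_mono) simp
    then show "(\<Sum>\<^sub>\<infinity>v\<in>Chi E {u}. (lam v)\<^sup>2) \<le> B\<^sup>2 + 1"
      using u by (simp add: ell2_norm_wshift_indicator)
    have "1 \<le> D * ell2_norm V (?S ?e)"
      using D[OF Sm[OF e]] L[OF e] u by (simp add: ell2_norm_indicator)
    then have "1\<^sup>2 \<le> (D * ell2_norm V (?S ?e))\<^sup>2"
      by (rule power_mono) simp
    also have "\<dots> \<le> (D\<^sup>2 + 1) * (ell2_norm V (?S ?e))\<^sup>2"
      by (simp add: power_mult_distrib algebra_simps)
    finally show "1 / (D\<^sup>2 + 1) \<le> (\<Sum>\<^sub>\<infinity>v\<in>Chi E {u}. (lam v)\<^sup>2)"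
      using u by (simp add: ell2_norm_wshift_indicator divide_le_eq add_nonneg_pos mult.commute)
  qed
  then show ?thesis
    by blast
qed

theorem theorem1p3:
  fixes V :: "'v set" and E :: "('v \<times> 'v) set" and lam lam' :: "'v \<Rightarrow> real"
  assumes "directed_tree V E" and "rootless V E" and "leafless V E"
    and "countable V" and "infinite V"
    and "\<forall>v\<in>V. lam v > 0"
    and "bounded_operator V (wshift V E lam)" and "left_invertible V (wshift V E lam)"
    and "\<forall>v\<in>V. lam' v = lam v / (ell2_norm V (wshift V E lam (indicator {par E v})))\<^sup>2"
  shows
    "(let cond_i = (\<exists>v\<in>V. alpha E lam v = \<infinity> \<and> alpha E lam' v = \<infinity>);
          cond_ii = ((\<exists>v\<in>V. alpha E lam v < \<infinity>) \<and>
                     (\<exists>p. bilateral_path V E p \<and> (\<forall>m. alpha_weight_eq E lam (p m))) \<and>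
                     balanced V E lam)
      in wold_type_decomposition V (wshift V E lam) \<longleftrightarrow>
           (cond_i \<and> \<not> cond_ii) \<or> (\<not> cond_i \<and> cond_ii))
     \<and>
     ((\<exists>v\<in>V. alpha E lam v = \<infinity> \<and> alpha E lam' v = \<infinity>) \<longleftrightarrow>
      (\<forall>v\<in>V. alpha E lam v = \<infinity> \<and> alpha E lam' v = \<infinity>))
     \<and>
     ((\<exists>v\<in>V. alpha E lam v < \<infinity>) \<longleftrightarrow> (\<forall>v\<in>V. alpha E lam v < \<infinity>))
     \<and>
     ((\<exists>v\<in>V. alpha E lam v < \<infinity>) \<longrightarrow>
      ((\<exists>p. bilateral_path V E p \<and> (\<forall>m. alpha_weight_eq E lam (p m))) \<longleftrightarrow>
       (\<forall>v\<in>V. alpha_weight_eq E lam v)))"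
proof -
  have tree: "rootless_leafless_tree V E"
    using assms by unfold_locales
  obtain c C where "weighted_tree V E lam c C"
    using weighted_tree_if_bounded_left_invertible[OF tree] assms by blast
  then interpret weighted_tree V E lam c C .
  interpret cauchy_dual_pair V E lam c C lam'
    using assms(9) by unfold_locales (simp add: child_mass_eq_norm)
  have ne: "V \<noteq> {}"
    using \<open>infinite V\<close> by auto
  then obtain v0 where v0: "v0 \<in> V"
    by blast
  define A where "A \<longleftrightarrow> alpha E lam v0 < \<infinity>"
  define A' where "A' \<longleftrightarrow> alpha E lam' v0 < \<infinity>"
  have A: "alpha E lam v < \<infinity> \<longleftrightarrow> A" "alpha E lam v = \<infinity> \<longleftrightarrow> \<not> A" if "v \<in> V" for v
    using alpha_finite_cong[OF that v0] by (auto simp: A_def less_top[symmetric])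
  have A': "alpha E lam' v = \<infinity> \<longleftrightarrow> \<not> A'" if "v \<in> V" for v
    using dual.alpha_finite_cong[OF that v0] by (auto simp: A'_def less_top[symmetric])
  have path: "(\<exists>p. bilateral_path V E p \<and> (\<forall>m. alpha_weight_eq E lam (p m))) \<longleftrightarrow>
      (\<forall>v\<in>V. alpha_weight_eq E lam v)" if A
  proof
    assume "\<forall>v\<in>V. alpha_weight_eq E lam v"
    then show "\<exists>p. bilateral_path V E p \<and> (\<forall>m. alpha_weight_eq E lam (p m))"
      using bilateral_path_exists[OF ne] bilateral_path_in by blast
  next
    assume "\<exists>p. bilateral_path V E p \<and> (\<forall>m. alpha_weight_eq E lam (p m))"
    then obtain p where p: "bilateral_path V E p" "\<And>m. alpha_weight_eq E lam (p m)"
      by blast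
    show "\<forall>v\<in>V. alpha_weight_eq E lam v"
    proof
      fix v assume v: "v \<in> V"
      then obtain m where "same_generation E (p m) v"
        using bilateral_path_meets_generation[OF p(1)] by blast
      then show "alpha_weight_eq E lam v"
        using alpha_weight_eq_cong[of "p m" v] bilateral_path_in[OF p(1), of m] p(2)[of m] v
          A(1)[OF v] \<open>A\<close> alpha_finite_iff[OF v] by simp
    qed
  qed
  have i: "(\<exists>v\<in>V. alpha E lam v = \<infinity> \<and> alpha E lam' v = \<infinity>) \<longleftrightarrow> \<not> A \<and> \<not> A'"
    "(\<forall>v\<in>V. alpha E lam v = \<infinity> \<and> alpha E lam' v = \<infinity>) \<longleftrightarrow> \<not> A \<and> \<not> A'"
    and ii: "(\<exists>v\<in>V. alpha E lam v < \<infinity>) \<longleftrightarrow> A" "(\<forall>v\<in>V. alpha E lam v < \<infinity>) \<longleftrightarrow> A"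
    using A A' v0 by blast+
  have wold: "wold_type_decomposition V S \<longleftrightarrow> (if A then (\<forall>v\<in>V. alpha_weight_eq E lam v) \<and> balanced V E lam else \<not> A')"
  proof (cases A)
    case True
    then show ?thesis
      using wold_iff_if_alpha_finite A(1) by simp
  next
    case False
    then show ?thesis
      using wold_iff_if_alpha_infinite A(2) A' ne by auto
  qed
  show ?thesis
    unfolding Let_def i ii wold using path by auto
qed

end
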